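(* Let $X=\mathbb{R}\oplus_1\ell_2$ (or, in the complex case, $X=\mathbb{C}\oplus_1\ell_2$). Each of the following equivalence relations between infinite-dimensional subspaces of $X$ is Borel bireducible to $(\mathbb{R},=)$: (i) isometry; (ii) having Banach–Mazur distance $1$; (iii) isometric bi-embeddability; (iv) almost isometric bi-embeddability.
   Context: $\oplus_1$ denotes the $\ell_1$-direct sum: $\|s\oplus\xi\|=|s|+\|\xi\|$. The set $\mathbf{S}(X)$ of infinite-dimensional closed subspaces of $X$ carries the Effros–Borel structure (generated by the sets $\{Y:Y\cap U\neq\emptyset\}$, $U\subset X$ open). The Banach–Mazur distance is $d(Y,Z)=\inf\{\|u\|\,\|u^{-1}\|: u\in B(Y,Z)\text{ an isomorphism}\}$. $Y$ is almost isometrically embeddable into $Z$ if for every $\varepsilon>0$ there is a subspace $Y_\varepsilon$ of $Z$ with $d(Y,Y_\varepsilon)<1+\varepsilon$. Two spaces are (almost) isometrically bi-embeddable if each is (almost) isometrically embeddable into the other. An equivalence relation $E$ on a standard Borel space $S$ is Borel reducible to an equivalence relation $F$ on a standard Borel space $T$ if there is a Borel map $f:S\to T$ with $x\,E\,y\Leftrightarrow f(x)\,F\,f(y)$; they are Borel bireducible if each is Borel reducible to the other. *)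

theory Defs
  imports "HOL-Analysis.Analysis"
begin

section \<open>The space \<open>\<ell>\<^sub>2\<close>\<close>

typedef (overloaded) 'a ell2 =
  "{f :: nat \<Rightarrow> 'a :: real_normed_vector. summable (\<lambda>n. (norm (f n))\<^sup>2)}"
  morphisms ell2_nth Abs_ell2
  by (rule exI[of _ "\<lambda>_. 0"]) simp

setup_lifting type_definition_ell2

lemma summable_sq_norm_add:
  fixes f g :: "nat \<Rightarrow> 'a :: real_normed_vector"
  assumes "summable (\<lambda>n. (norm (f n))\<^sup>2)" "summable (\<lambda>n. (norm (g n))\<^sup>2)"
  shows "summable (\<lambda>n. (norm (f n + g n))\<^sup>2)"
proof (rule summable_comparison_test')
  show "summable (\<lambda>n. 2 * (norm (f n))\<^sup>2 + 2 * (norm (g n))\<^sup>2)"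
    using assms by (intro summable_add summable_mult)
  fix n :: nat
  have "(norm (f n + g n))\<^sup>2 \<le> (norm (f n) + norm (g n))\<^sup>2"
    by (intro power_mono norm_triangle_ineq) auto
  also have "\<dots> \<le> 2 * (norm (f n))\<^sup>2 + 2 * (norm (g n))\<^sup>2"
    using sum_squares_bound[of "norm (f n)" "norm (g n)"]
    by (simp add: power2_sum)
  finally show "norm ((norm (f n + g n))\<^sup>2) \<le> 2 * (norm (f n))\<^sup>2 + 2 * (norm (g n))\<^sup>2"
    by simp
qed

lemma sqrt_suminf_sq_norm_triangle:
  fixes f g :: "nat \<Rightarrow> 'a :: real_normed_vector"
  assumes f: "summable (\<lambda>n. (norm (f n))\<^sup>2)" and g: "summable (\<lambda>n. (norm (g n))\<^sup>2)"
  shows "sqrt (\<Sum>n. (norm (f n + g n))\<^sup>2)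
           \<le> sqrt (\<Sum>n. (norm (f n))\<^sup>2) + sqrt (\<Sum>n. (norm (g n))\<^sup>2)"
proof (rule LIMSEQ_le)
  show "(\<lambda>N. sqrt (\<Sum>n<N. (norm (f n + g n))\<^sup>2)) \<longlonglongrightarrow> sqrt (\<Sum>n. (norm (f n + g n))\<^sup>2)"
    using summable_LIMSEQ[OF summable_sq_norm_add[OF f g]] by (rule tendsto_real_sqrt)
  show "(\<lambda>N. sqrt (\<Sum>n<N. (norm (f n))\<^sup>2) + sqrt (\<Sum>n<N. (norm (g n))\<^sup>2))
          \<longlonglongrightarrow> sqrt (\<Sum>n. (norm (f n))\<^sup>2) + sqrt (\<Sum>n. (norm (g n))\<^sup>2)"
    using summable_LIMSEQ[OF f] summable_LIMSEQ[OF g] by (intro tendsto_add tendsto_real_sqrt)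
  have "sqrt (\<Sum>n<N. (norm (f n + g n))\<^sup>2)
          \<le> sqrt (\<Sum>n<N. (norm (f n))\<^sup>2) + sqrt (\<Sum>n<N. (norm (g n))\<^sup>2)" for N
  proof -
    have "sqrt (\<Sum>n<N. (norm (f n + g n))\<^sup>2) \<le> L2_set (\<lambda>n. norm (f n) + norm (g n)) {..<N}"
      unfolding L2_set_def
      by (intro real_sqrt_le_mono sum_mono power_mono norm_triangle_ineq) auto
    also have "\<dots> \<le> L2_set (\<lambda>n. norm (f n)) {..<N} + L2_set (\<lambda>n. norm (g n)) {..<N}"
      by (rule L2_set_triangle_ineq)
    finally show ?thesis by (simp add: L2_set_def)
  qed
  then show "\<exists>N. \<forall>n\<ge>N. sqrt (\<Sum>k<n. (norm (f k + g k))\<^sup>2)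
          \<le> sqrt (\<Sum>k<n. (norm (f k))\<^sup>2) + sqrt (\<Sum>k<n. (norm (g k))\<^sup>2)" by blast
qed

instantiation ell2 :: (real_normed_vector) real_normed_vector
begin

lift_definition zero_ell2 :: "'a ell2" is "\<lambda>_. 0" by simp

lift_definition plus_ell2 :: "'a ell2 \<Rightarrow> 'a ell2 \<Rightarrow> 'a ell2" is "\<lambda>f g n. f n + g n"
  by (rule summable_sq_norm_add)

lift_definition uminus_ell2 :: "'a ell2 \<Rightarrow> 'a ell2" is "\<lambda>f n. - f n" by simp

lift_definition minus_ell2 :: "'a ell2 \<Rightarrow> 'a ell2 \<Rightarrow> 'a ell2" is "\<lambda>f g n. f n - g n"
  using summable_sq_norm_add[of f "\<lambda>n. - g n" for f g] by auto

lift_definition scaleR_ell2 :: "real \<Rightarrow> 'a ell2 \<Rightarrow> 'a ell2" is "\<lambda>r f n. r *\<^sub>R f n"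
  by (simp add: power_mult_distrib summable_mult)

lift_definition norm_ell2 :: "'a ell2 \<Rightarrow> real" is "\<lambda>f. sqrt (\<Sum>n. (norm (f n))\<^sup>2)" .

definition dist_ell2 :: "'a ell2 \<Rightarrow> 'a ell2 \<Rightarrow> real"
  where "dist_ell2 x y = norm (x - y)"

definition sgn_ell2 :: "'a ell2 \<Rightarrow> 'a ell2"
  where "sgn_ell2 x = inverse (norm x) *\<^sub>R x"

definition [code del]:
  "(uniformity :: ('a ell2 \<times> 'a ell2) filter) = (INF e\<in>{0 <..}. principal {(x, y). dist x y < e})"

definition open_ell2 :: "'a ell2 set \<Rightarrow> bool"
  where [code del]: "open_ell2 S = (\<forall>x\<in>S. \<forall>\<^sub>F (x', y) in uniformity. x' = x \<longrightarrow> y \<in> S)"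

instance
proof
  fix x y :: "'a ell2" and r :: real
  show "norm x = 0 \<longleftrightarrow> x = 0"
  proof (transfer, safe)
    fix f :: "nat \<Rightarrow> 'a"
    assume f: "summable (\<lambda>n. (norm (f n))\<^sup>2)" and "sqrt (\<Sum>n. (norm (f n))\<^sup>2) = 0"
    then have "(norm (f n))\<^sup>2 = 0" for n
      using suminf_eq_zero_iff[OF f] by simp
    then show "f = (\<lambda>_. 0)" by auto
  qed simp
  show "norm (x + y) \<le> norm x + norm y"
    by transfer (rule sqrt_suminf_sq_norm_triangle)
  show "norm (r *\<^sub>R x) = \<bar>r\<bar> * norm x"
    by transfer (simp add: power_mult_distrib suminf_mult real_sqrt_mult)
qed (unfold dist_ell2_def sgn_ell2_def uniformity_ell2_def open_ell2_def,
     (rule refl | (transfer, force simp: algebra_simps))+)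

end

lift_definition scale_ell2 :: "'k :: real_normed_field \<Rightarrow> 'k ell2 \<Rightarrow> 'k ell2"
  is "\<lambda>c f n. c * f n"
  by (simp add: norm_mult power_mult_distrib summable_mult)

lemma scale_ell2_algebra:
  "scale_ell2 c (x + y) = scale_ell2 c x + scale_ell2 c y"
  "scale_ell2 (c + d) x = scale_ell2 c x + scale_ell2 d x"
  "scale_ell2 c (scale_ell2 d x) = scale_ell2 (c * d) x"
  "scale_ell2 1 x = x"
  "scale_ell2 (of_real r) x = r *\<^sub>R x"
  by (transfer, simp add: algebra_simps scaleR_conv_of_real)+

lemma norm_scale_ell2: "norm (scale_ell2 c x) = norm c * norm x"
  by transfer (simp add: norm_mult power_mult_distrib suminf_mult real_sqrt_mult)

section \<open>The \<open>\<ell>\<^sub>1\<close>-direct sum\<close>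

(* A separate type, because the library's product type carries the l2-sum norm. *)
datatype ('a, 'b) l1sum = Oplus (l1_fst: 'a) (l1_snd: 'b)  (infixr \<open>\<oplus>\<^sub>1\<close> 65)

instantiation l1sum :: (real_normed_vector, real_normed_vector) real_normed_vector
begin

definition zero_l1sum :: "('a, 'b) l1sum"
  where "zero_l1sum = 0 \<oplus>\<^sub>1 0"

definition plus_l1sum :: "('a, 'b) l1sum \<Rightarrow> ('a, 'b) l1sum \<Rightarrow> ('a, 'b) l1sum"
  where "plus_l1sum x y = (l1_fst x + l1_fst y) \<oplus>\<^sub>1 (l1_snd x + l1_snd y)"

definition uminus_l1sum :: "('a, 'b) l1sum \<Rightarrow> ('a, 'b) l1sum"
  where "uminus_l1sum x = (- l1_fst x) \<oplus>\<^sub>1 (- l1_snd x)"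

definition minus_l1sum :: "('a, 'b) l1sum \<Rightarrow> ('a, 'b) l1sum \<Rightarrow> ('a, 'b) l1sum"
  where "minus_l1sum x y = (l1_fst x - l1_fst y) \<oplus>\<^sub>1 (l1_snd x - l1_snd y)"

definition scaleR_l1sum :: "real \<Rightarrow> ('a, 'b) l1sum \<Rightarrow> ('a, 'b) l1sum"
  where "scaleR_l1sum r x = (r *\<^sub>R l1_fst x) \<oplus>\<^sub>1 (r *\<^sub>R l1_snd x)"

definition norm_l1sum :: "('a, 'b) l1sum \<Rightarrow> real"
  where "norm_l1sum x = norm (l1_fst x) + norm (l1_snd x)"

definition dist_l1sum :: "('a, 'b) l1sum \<Rightarrow> ('a, 'b) l1sum \<Rightarrow> real"
  where "dist_l1sum x y = norm (x - y)"

definition sgn_l1sum :: "('a, 'b) l1sum \<Rightarrow> ('a, 'b) l1sum"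
  where "sgn_l1sum x = inverse (norm x) *\<^sub>R x"

definition [code del]:
  "(uniformity :: (('a, 'b) l1sum \<times> ('a, 'b) l1sum) filter)
     = (INF e\<in>{0 <..}. principal {(x, y). dist x y < e})"

definition open_l1sum :: "('a, 'b) l1sum set \<Rightarrow> bool"
  where [code del]: "open_l1sum S = (\<forall>x\<in>S. \<forall>\<^sub>F (x', y) in uniformity. x' = x \<longrightarrow> y \<in> S)"

instance
proof
  fix x y :: "('a, 'b) l1sum" and r :: real
  show "norm x = 0 \<longleftrightarrow> x = 0"
    by (cases x) (simp add: norm_l1sum_def zero_l1sum_def add_nonneg_eq_0_iff)
  show "norm (x + y) \<le> norm x + norm y"
    using norm_triangle_ineq[of "l1_fst x" "l1_fst y"] norm_triangle_ineq[of "l1_snd x" "l1_snd y"]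
    by (simp add: norm_l1sum_def plus_l1sum_def)
  show "norm (r *\<^sub>R x) = \<bar>r\<bar> * norm x"
    by (simp add: norm_l1sum_def scaleR_l1sum_def algebra_simps)
qed (simp_all add: dist_l1sum_def sgn_l1sum_def uniformity_l1sum_def open_l1sum_def
       zero_l1sum_def plus_l1sum_def uminus_l1sum_def minus_l1sum_def scaleR_l1sum_def
       algebra_simps)

end

section \<open>Subspaces of a normed space over a field of scalars\<close>

(* The library has no class of complex normed spaces.  The scalar field is a parameter here, so
   that subspaces and linear maps are over the field 'k (real or complex); the topology is the
   one of the norm. *)
locale normed_space_over = vector_space scale
  for scale :: "'k :: real_normed_field \<Rightarrow> 'b :: real_normed_vector \<Rightarrow> 'b" +
  assumes scale_of_real: "scale (of_real r) x = r *\<^sub>R x"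
    and norm_scale: "norm (scale c x) = norm c * norm x"
begin

definition infinite_dimensional :: "'b set \<Rightarrow> bool"
  where "infinite_dimensional Y \<longleftrightarrow> \<not> (\<exists>B. finite B \<and> span B = Y)"

definition subspaces :: "'b set set"
  where "subspaces = {Y. subspace Y \<and> closed Y \<and> infinite_dimensional Y}"

definition effros :: "'b set measure"
  where "effros = sigma subspaces ((\<lambda>U. {Y \<in> subspaces. Y \<inter> U \<noteq> {}}) ` {U. open U})"

definition linear_on :: "'b set \<Rightarrow> ('b \<Rightarrow> 'b) \<Rightarrow> bool"
  where "linear_on Y u \<longleftrightarrow>
    (\<forall>x\<in>Y. \<forall>y\<in>Y. u (x + y) = u x + u y) \<and> (\<forall>c. \<forall>x\<in>Y. u (scale c x) = scale c (u x))"

definition bounded_on :: "'b set \<Rightarrow> ('b \<Rightarrow> 'b) \<Rightarrow> bool"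
  where "bounded_on Y u \<longleftrightarrow> (\<exists>C. \<forall>x\<in>Y. norm (u x) \<le> C * norm x)"

definition onorm_on :: "'b set \<Rightarrow> ('b \<Rightarrow> 'b) \<Rightarrow> real"
  where "onorm_on Y u = (SUP x\<in>Y. norm (u x) / norm x)"

definition isomorphisms :: "'b set \<Rightarrow> 'b set \<Rightarrow> ('b \<Rightarrow> 'b) set"
  where "isomorphisms Y Z =
    {u. linear_on Y u \<and> bij_betw u Y Z \<and> bounded_on Y u \<and> bounded_on Z (inv_into Y u)}"

(* Extended real, so that the distance of non-isomorphic spaces is infinite. *)
definition banach_mazur :: "'b set \<Rightarrow> 'b set \<Rightarrow> ereal"
  where "banach_mazur Y Z =
    (INF u\<in>isomorphisms Y Z. ereal (onorm_on Y u * onorm_on Z (inv_into Y u)))"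

definition isometric :: "'b set \<Rightarrow> 'b set \<Rightarrow> bool"
  where "isometric Y Z \<longleftrightarrow>
    (\<exists>u. linear_on Y u \<and> bij_betw u Y Z \<and> (\<forall>x\<in>Y. norm (u x) = norm x))"

definition isometrically_embeddable :: "'b set \<Rightarrow> 'b set \<Rightarrow> bool"
  where "isometrically_embeddable Y Z \<longleftrightarrow> (\<exists>W. subspace W \<and> W \<subseteq> Z \<and> isometric Y W)"

(* W need not be assumed closed: if Y is complete, then so is any W at finite distance from Y. *)
definition almost_isometrically_embeddable :: "'b set \<Rightarrow> 'b set \<Rightarrow> bool"
  where "almost_isometrically_embeddable Y Z \<longleftrightarrow>
    (\<forall>\<epsilon>>0. \<exists>W. subspace W \<and> W \<subseteq> Z \<and> banach_mazur Y W < ereal (1 + \<epsilon>))"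

definition isometry_rel :: "('b set \<times> 'b set) set"
  where "isometry_rel = {(Y, Z) \<in> subspaces \<times> subspaces. isometric Y Z}"

definition distance_one_rel :: "('b set \<times> 'b set) set"
  where "distance_one_rel = {(Y, Z) \<in> subspaces \<times> subspaces. banach_mazur Y Z = 1}"

definition isometric_biembeddability_rel :: "('b set \<times> 'b set) set"
  where "isometric_biembeddability_rel = {(Y, Z) \<in> subspaces \<times> subspaces.
    isometrically_embeddable Y Z \<and> isometrically_embeddable Z Y}"

definition almost_isometric_biembeddability_rel :: "('b set \<times> 'b set) set"
  where "almost_isometric_biembeddability_rel = {(Y, Z) \<in> subspaces \<times> subspaces.
    almost_isometrically_embeddable Y Z \<and> almost_isometrically_embeddable Z Y}"

end

section \<open>The space \<open>\<real> \<oplus>\<^sub>1 \<ell>\<^sub>2\<close> or \<open>\<complex> \<oplus>\<^sub>1 \<ell>\<^sub>2\<close>\<close>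

type_synonym 'k X = "('k, 'k ell2) l1sum"

definition scale_X :: "'k :: real_normed_field \<Rightarrow> 'k X \<Rightarrow> 'k X"
  where "scale_X c x = (c * l1_fst x) \<oplus>\<^sub>1 scale_ell2 c (l1_snd x)"

global_interpretation X: normed_space_over scale_X
  by unfold_locales
    (simp_all add: scale_X_def plus_l1sum_def scaleR_l1sum_def norm_l1sum_def scale_ell2_algebra
      norm_scale_ell2 norm_mult scaleR_conv_of_real algebra_simps)

section \<open>Borel reducibility\<close>

(* Only the Borel structures of the underlying spaces enter; the intended M and N are
   standard Borel. *)
definition borel_reducible ::
    "'a measure \<Rightarrow> ('a \<times> 'a) set \<Rightarrow> 'b measure \<Rightarrow> ('b \<times> 'b) set \<Rightarrow> bool"
  where "borel_reducible M E N F \<longleftrightarrow>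
    equiv (space M) E \<and> equiv (space N) F \<and>
    (\<exists>f\<in>measurable M N. \<forall>x\<in>space M. \<forall>y\<in>space M. (x, y) \<in> E \<longleftrightarrow> (f x, f y) \<in> F)"

definition borel_bireducible ::
    "'a measure \<Rightarrow> ('a \<times> 'a) set \<Rightarrow> 'b measure \<Rightarrow> ('b \<times> 'b) set \<Rightarrow> bool"
  where "borel_bireducible M E N F \<longleftrightarrow> borel_reducible M E N F \<and> borel_reducible N F M E"

end

theory Submission
  imports Defs
begin

text \<open>
A closed infinite-dimensional subspace \<open>Y\<close> of the \<open>\<ell>\<^sub>1\<close>-sum of the scalars and \<open>\<ell>\<^sub>2\<close> is, up to isometry, described by
one number.  Unless \<open>Y\<close> lies in \<open>\<ell>\<^sub>2\<close>, it is the sum of a closed subspace \<open>V\<close> of \<open>\<ell>\<^sub>2\<close> and of the line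
spanned by a vector \<open>1 \<oplus> h\<close> with \<open>h\<close> orthogonal to \<open>V\<close>.  All such \<open>V\<close> are isometric to
\<open>\<ell>\<^sub>2\<close>, so the norm of \<open>Y\<close> depends only on \<open>\<parallel>h\<parallel>\<close>.  With \<open>s = 1 / (1 + \<parallel>h\<parallel>)\<close>, and \<open>s = 0\<close> if \<open>Y\<close> lies in \<open>\<ell>\<^sub>2\<close>, the
space \<open>Y\<close> carries the norm \<open>s \<bar>a\<bar> + sqrt ((1 - s)\<^sup>2 \<bar>a\<bar>\<^sup>2 + \<parallel>f\<parallel>\<^sup>2)\<close> (\<open>profile_exists\<close>).

The number \<open>s\<close> can be recovered from the von Neumann--Jordan constant of \<open>Y\<close>, the best constant in the
parallelogram inequality, which equals \<open>2 / (2 - s)\<close> (\<open>jordan_neumann_profile\<close>).  This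
constant is an isometric invariant that can only grow under almost isometric embeddings
(\<open>jordan_neumann_mono_almost_embeddable\<close>).  Consequently equality of the constants implies isometry, isometry
implies the three other relations, and all of them imply equality of the constants: the four
relations are one and the same (\<open>relations_eq_jordan_neumann_rel\<close>).

The constant itself reduces this relation to equality of real numbers; it is Effros--Borel
because exceeding a given bound is an open condition on pairs of vectors
(\<open>borel_measurable_jordan_neumann\<close>).  Conversely, taking \<open>h = exp r\<close> times a unit vector and \<open>V\<close> its orthogonal complement
gives a Borel family of subspaces that are distinguished by \<open>r\<close>
(\<open>measurable_slope_subspace\<close>, \<open>jordan_neumann_slope_subspace_inj\<close>).
\<close>

section \<open>Coordinates and completeness of \<open>\<ell>\<^sub>2\<close>\<close>

lemma summable_ell2_nth: "summable (\<lambda>n. (norm (ell2_nth f n))\<^sup>2)"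
  using ell2_nth[of f] by simp

lemma ell2_eqI: "(\<And>n. ell2_nth f n = ell2_nth g n) \<Longrightarrow> f = g"
  by (simp add: ell2_nth_inject[symmetric] ext)

lemma norm_ell2_sq: "(norm f)\<^sup>2 = (\<Sum>n. (norm (ell2_nth f n))\<^sup>2)"
  by (simp add: norm_ell2.rep_eq suminf_nonneg summable_ell2_nth)

lemma partial_sum_le_norm_ell2_sq: "(\<Sum>n<N. (norm (ell2_nth f n))\<^sup>2) \<le> (norm f)\<^sup>2"
  unfolding norm_ell2_sq by (intro sum_le_suminf summable_ell2_nth) auto

lemma norm_ell2_nth_le: "norm (ell2_nth f n) \<le> norm f"
proof (rule power2_le_imp_le)
  have "(norm (ell2_nth f n))\<^sup>2 \<le> (\<Sum>i<Suc n. (norm (ell2_nth f i))\<^sup>2)"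
    by (rule member_le_sum) auto
  then show "(norm (ell2_nth f n))\<^sup>2 \<le> (norm f)\<^sup>2"
    using partial_sum_le_norm_ell2_sq order_trans by blast
qed simp

lemma bounded_linear_ell2_nth: "bounded_linear (\<lambda>f. ell2_nth f n)"
  by (rule bounded_linear_intro[where K = 1])
     (auto simp: plus_ell2.rep_eq scaleR_ell2.rep_eq norm_ell2_nth_le)

lemmas continuous_on_ell2_nth [continuous_intros] =
  bounded_linear.continuous_on[OF bounded_linear_ell2_nth]

text \<open>Bounds on the partial sums of squares say at once that a sequence is square summable and how
far it is from a given element: this is all that completeness needs, since bounds on partial sums pass to
coordinatewise limits.\<close>

lemma ell2_approximation:
  fixes g :: "nat \<Rightarrow> 'a::real_normed_vector"
  assumes "\<And>N. (\<Sum>i<N. (norm (ell2_nth x i - g i))\<^sup>2) \<le> e\<^sup>2" "e \<ge> 0"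
  shows "summable (\<lambda>n. (norm (g n))\<^sup>2)" "norm (x - Abs_ell2 g) \<le> e"
proof -
  have d: "summable (\<lambda>i. (norm (ell2_nth x i - g i))\<^sup>2)"
    by (rule summableI_nonneg_bounded) (use assms in auto)
  have "summable (\<lambda>i. (norm (- (ell2_nth x i - g i) + ell2_nth x i))\<^sup>2)"
    by (rule summable_sq_norm_add[OF _ summable_ell2_nth], subst norm_minus_cancel, rule d)
  then show g: "summable (\<lambda>n. (norm (g n))\<^sup>2)" by simp
  have "(norm (x - Abs_ell2 g))\<^sup>2 = (\<Sum>i. (norm (ell2_nth x i - g i))\<^sup>2)"
    by (simp add: norm_ell2_sq minus_ell2.rep_eq Abs_ell2_inverse g)
  also have "\<dots> \<le> e\<^sup>2" by (rule suminf_le_const[OF d assms(1)])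
  finally show "norm (x - Abs_ell2 g) \<le> e"
    using assms(2) power2_le_imp_le by blast
qed

instance ell2 :: (banach) banach
proof
  fix X :: "nat \<Rightarrow> 'a ell2" assume X: "Cauchy X"
  define g where "g i = lim (\<lambda>n. ell2_nth (X n) i)" for i
  have g: "(\<lambda>n. ell2_nth (X n) i) \<longlonglongrightarrow> g i" for i
    using bounded_linear.Cauchy[OF bounded_linear_ell2_nth X, of i]
    unfolding g_def by (simp add: Cauchy_convergent_iff convergent_LIMSEQ_iff)
  have tail: "\<exists>M. \<forall>m\<ge>M. summable (\<lambda>n. (norm (g n))\<^sup>2) \<and> norm (X m - Abs_ell2 g) \<le> e"
    if "e > 0" for e
  proof -
    obtain M where M: "\<And>m n. m \<ge> M \<Longrightarrow> n \<ge> M \<Longrightarrow> norm (X m - X n) < e"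
      using CauchyD[OF X \<open>e > 0\<close>] by blast
    have "(\<Sum>i<N. (norm (ell2_nth (X m) i - g i))\<^sup>2) \<le> e\<^sup>2" if "m \<ge> M" for m N
    proof (rule Lim_bounded)
      show "(\<lambda>n. \<Sum>i<N. (norm (ell2_nth (X m) i - ell2_nth (X n) i))\<^sup>2)
              \<longlonglongrightarrow> (\<Sum>i<N. (norm (ell2_nth (X m) i - g i))\<^sup>2)"
        by (intro tendsto_intros g)
      show "\<forall>n\<ge>M. (\<Sum>i<N. (norm (ell2_nth (X m) i - ell2_nth (X n) i))\<^sup>2) \<le> e\<^sup>2"
      proof (intro allI impI)
        fix n assume "n \<ge> M"
        have "(\<Sum>i<N. (norm (ell2_nth (X m) i - ell2_nth (X n) i))\<^sup>2) \<le> (norm (X m - X n))\<^sup>2"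
          using partial_sum_le_norm_ell2_sq[of "X m - X n" N] by (simp add: minus_ell2.rep_eq)
        also have "\<dots> \<le> e\<^sup>2"
          using M[OF \<open>m \<ge> M\<close> \<open>n \<ge> M\<close>] by (intro power_mono) auto
        finally show "(\<Sum>i<N. (norm (ell2_nth (X m) i - ell2_nth (X n) i))\<^sup>2) \<le> e\<^sup>2" .
      qed
    qed
    then show ?thesis
      using \<open>e > 0\<close>
      by (intro exI[of _ M] allI impI conjI ell2_approximation[where e = e]) (assumption | simp)+
  qed
  have "X \<longlonglongrightarrow> Abs_ell2 g"
  proof (rule LIMSEQ_I)
    fix r :: real assume "r > 0"
    then obtain M where "\<forall>m\<ge>M. norm (X m - Abs_ell2 g) \<le> r / 2"
      using tail[of "r / 2"] by auto
    moreover have "r / 2 < r" using \<open>r > 0\<close> by simp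
    ultimately have "\<forall>m\<ge>M. norm (X m - Abs_ell2 g) < r" using le_less_trans by blast
    then show "\<exists>no. \<forall>n\<ge>no. norm (X n - Abs_ell2 g) < r"
      by blast
  qed
  then show "convergent X" by (rule convergentI)
qed

section \<open>Real and complex scalars, and the inner product of \<open>\<ell>\<^sub>2\<close>\<close>

text \<open>The class has the two instances \<open>\<real>\<close> and \<open>\<complex>\<close>, so that
both scalar fields are treated by one argument. The conjugation gives \<open>\<ell>\<^sub>2\<close> a
scalar-valued inner product, whose values are the coefficients of orthogonal projections.\<close>

class conj_field = real_normed_field + euclidean_space +
  fixes conjugate :: "'a \<Rightarrow> 'a"
  assumes conjugate_add: "conjugate (x + y) = conjugate x + conjugate y"
    and conjugate_mult: "conjugate (x * y) = conjugate x * conjugate y"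
    and conjugate_conjugate: "conjugate (conjugate x) = x"
    and mult_conjugate_scaleR: "x * conjugate x = (norm x)\<^sup>2 *\<^sub>R 1"

lemma mult_conjugate: "x * conjugate x = of_real ((norm (x :: 'k::conj_field))\<^sup>2)"
  by (simp add: mult_conjugate_scaleR of_real_def)

instantiation real :: conj_field
begin
definition conjugate_real :: "real \<Rightarrow> real" where "conjugate_real x = x"
instance by standard (auto simp: conjugate_real_def power2_eq_square)
end

instantiation complex :: conj_field
begin
definition conjugate_complex :: "complex \<Rightarrow> complex" where "conjugate_complex = cnj"
instance by standard (auto simp: conjugate_complex_def complex_mult_cnj cmod_def scaleR_conv_of_real)
end

global_interpretation L: normed_space_over "scale_ell2 :: 'k::real_normed_field \<Rightarrow> _"
  by unfold_locales (simp_all add: scale_ell2_algebra norm_scale_ell2)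

lemma norm_conjugate: "norm (conjugate x) = norm (x :: 'k::conj_field)"
proof (cases "x = 0")
  case True
  have "conjugate 0 + conjugate 0 = conjugate (0 :: 'k)"
    by (simp add: conjugate_add[symmetric])
  then show ?thesis using True by simp
next
  case False
  have "norm x * norm (conjugate x) = norm x * norm x"
    using arg_cong[OF mult_conjugate[of x], of norm]
    by (simp add: norm_mult power2_eq_square)
  then show ?thesis using False by simp
qed

lemma conjugate_of_real: "conjugate (of_real r) = (of_real r :: 'k::conj_field)"
proof (cases "r = 0")
  case True
  then show ?thesis using norm_conjugate[of "0::'k"] by simp
next
  case False
  then show ?thesis
    using mult_conjugate[of "of_real r :: 'k"] by (simp add: power2_eq_square)
qed

lemma conjugate_simps [simp]: "conjugate 0 = (0 :: 'k::conj_field)" "conjugate 1 = (1 :: 'k)"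
  using conjugate_of_real[of 0, where 'k='k] conjugate_of_real[of 1, where 'k='k] by simp_all

lemma bounded_linear_conjugate: "bounded_linear (conjugate :: 'k::conj_field \<Rightarrow> 'k)"
  by (rule bounded_linear_intro[where K = 1])
     (auto simp: conjugate_add norm_conjugate scaleR_conv_of_real conjugate_mult conjugate_of_real)

definition ell2_inner :: "'k::conj_field ell2 \<Rightarrow> 'k ell2 \<Rightarrow> 'k"
  where "ell2_inner f g = (\<Sum>n. ell2_nth f n * conjugate (ell2_nth g n))"

lemma summable_ell2_inner:
  fixes f g :: "'k::conj_field ell2"
  shows "summable (\<lambda>n. ell2_nth f n * conjugate (ell2_nth g n))"
proof (rule summable_comparison_test'[of _ 0])
  show "summable (\<lambda>n. (norm (ell2_nth f n))\<^sup>2 + (norm (ell2_nth g n))\<^sup>2)"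
    by (intro summable_add summable_ell2_nth)
  show "norm (ell2_nth f n * conjugate (ell2_nth g n))
          \<le> (norm (ell2_nth f n))\<^sup>2 + (norm (ell2_nth g n))\<^sup>2" for n
    using sum_squares_bound[of "norm (ell2_nth f n)" "norm (ell2_nth g n)"]
      mult_nonneg_nonneg[of "norm (ell2_nth f n)" "norm (ell2_nth g n)"]
    by (simp add: norm_mult norm_conjugate del: mult_nonneg_nonneg zero_le_mult_iff)
qed

lemma ell2_inner_add_left: "ell2_inner (f + g) h = ell2_inner f h + ell2_inner g h"
  unfolding ell2_inner_def
  by (simp add: plus_ell2.rep_eq algebra_simps suminf_add summable_ell2_inner)

lemma ell2_inner_scale_left: "ell2_inner (scale_ell2 c f) h = c * ell2_inner f h"
  unfolding ell2_inner_def
  by (simp add: scale_ell2.rep_eq mult.assoc suminf_mult summable_ell2_inner)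

lemma conjugate_ell2_inner: "conjugate (ell2_inner f g) = ell2_inner g f"
  unfolding ell2_inner_def
  by (subst bounded_linear.suminf[OF bounded_linear_conjugate summable_ell2_inner])
     (simp add: conjugate_mult conjugate_conjugate mult.commute)

lemma ell2_inner_add_right: "ell2_inner h (f + g) = ell2_inner h f + ell2_inner h g"
  by (metis conjugate_ell2_inner conjugate_add ell2_inner_add_left)

lemma ell2_inner_scale_right: "ell2_inner h (scale_ell2 c f) = conjugate c * ell2_inner h f"
  by (metis conjugate_ell2_inner conjugate_mult ell2_inner_scale_left)

lemma ell2_inner_self: "ell2_inner f f = of_real ((norm f)\<^sup>2)"
  unfolding ell2_inner_def mult_conjugate norm_ell2_sq
  by (rule suminf_of_real[OF summable_ell2_nth, symmetric])

lemma ell2_inner_zero [simp]: "ell2_inner 0 f = 0" "ell2_inner f 0 = 0"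
  by (simp_all add: ell2_inner_def zero_ell2.rep_eq)

lemma ell2_inner_diff_left: "ell2_inner (f - g) h = ell2_inner f h - ell2_inner g h"
  by (metis diff_add_cancel ell2_inner_add_left add_diff_cancel_right')

lemma ell2_inner_diff_right: "ell2_inner h (f - g) = ell2_inner h f - ell2_inner h g"
  by (metis diff_add_cancel ell2_inner_add_right add_diff_cancel_right')

lemma ell2_pythagoras:
  assumes "ell2_inner f g = 0"
  shows "(norm (f + g))\<^sup>2 = (norm f)\<^sup>2 + (norm g)\<^sup>2"
proof -
  have "ell2_inner g f = 0" using assms by (metis conjugate_ell2_inner conjugate_simps(1))
  then have "(of_real ((norm (f + g))\<^sup>2) :: 'a) = of_real ((norm f)\<^sup>2 + (norm g)\<^sup>2)"
    using assms unfolding ell2_inner_self[symmetric] of_real_add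
    by (simp add: ell2_inner_add_left ell2_inner_add_right)
  then show ?thesis by (simp only: of_real_eq_iff)
qed

lemma ell2_parallelogram:
  fixes f g :: "'k::conj_field ell2"
  shows "(norm (f + g))\<^sup>2 + (norm (f - g))\<^sup>2 = 2 * ((norm f)\<^sup>2 + (norm g)\<^sup>2)"
proof -
  have "(of_real ((norm (f + g))\<^sup>2 + (norm (f - g))\<^sup>2) :: 'k) = of_real (2 * ((norm f)\<^sup>2 + (norm g)\<^sup>2))"
    unfolding of_real_add of_real_mult ell2_inner_self[symmetric]
    by (simp add: ell2_inner_add_left ell2_inner_diff_left ell2_inner_add_right ell2_inner_diff_right)
  then show ?thesis by (simp only: of_real_eq_iff)
qed

lemma norm_ell2_inner_le: "norm (ell2_inner f g) \<le> norm f * norm g"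
proof (cases "g = 0")
  case False
  define c where "c = ell2_inner f g / of_real ((norm g)\<^sup>2)"
  have c: "norm c = norm (ell2_inner f g) / (norm g)\<^sup>2"
    by (simp add: c_def norm_divide norm_power)
  have "ell2_inner (f - scale_ell2 c g) (scale_ell2 c g) = 0"
    using False by (simp add: ell2_inner_diff_left ell2_inner_scale_left ell2_inner_scale_right
        ell2_inner_self c_def del: of_real_power)
  from ell2_pythagoras[OF this] have "(norm (scale_ell2 c g))\<^sup>2 \<le> (norm f)\<^sup>2"
    by simp
  then have "norm (scale_ell2 c g) \<le> norm f" by (rule power2_le_imp_le) simp
  then show ?thesis
    using False by (simp add: norm_scale_ell2 c power2_eq_square field_simps)
qed simp

lemma bounded_linear_ell2_inner_left: "bounded_linear (\<lambda>f. ell2_inner f g)"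
  by (rule bounded_linear_intro[where K = "norm g"])
     (auto simp: ell2_inner_add_left scale_ell2_algebra(5)[symmetric] ell2_inner_scale_left
        scaleR_conv_of_real norm_ell2_inner_le)

lemma bounded_linear_ell2_inner_right: "bounded_linear (\<lambda>g. ell2_inner f g)"
  by (rule bounded_linear_intro[where K = "norm f"])
     (auto simp: ell2_inner_add_right scale_ell2_algebra(5)[symmetric] ell2_inner_scale_right
        scaleR_conv_of_real conjugate_of_real norm_ell2_inner_le mult.commute[of _ "norm f"])

lemma bounded_linear_scale_ell2: "bounded_linear (scale_ell2 c)"
  by (rule bounded_linear_intro[where K = "norm c"])
     (auto simp: scale_ell2_algebra norm_scale_ell2 scale_ell2_algebra(5)[symmetric] mult.commute
        simp del: scale_ell2_algebra(5))

section \<open>Orthonormal bases of closed subspaces of \<open>\<ell>\<^sub>2\<close>\<close>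

text \<open>Sequences are indexed by all of \<open>nat\<close>, because only infinite-dimensional
subspaces get a basis; the linear combinations of such a sequence with square summable coefficients then
form an isometric copy of the whole of \<open>\<ell>\<^sub>2\<close>.\<close>

definition orthonormal :: "(nat \<Rightarrow> 'k::conj_field ell2) \<Rightarrow> bool"
  where "orthonormal e \<longleftrightarrow> (\<forall>i j. ell2_inner (e i) (e j) = (if i = j then 1 else 0))"

definition ell2_lincomb :: "(nat \<Rightarrow> 'k::conj_field ell2) \<Rightarrow> 'k ell2 \<Rightarrow> 'k ell2"
  where "ell2_lincomb e f = (\<Sum>n. scale_ell2 (ell2_nth f n) (e n))"

lemma orthonormal_finite_inner:
  assumes "orthonormal e" "finite I"
  shows "ell2_inner (\<Sum>i\<in>I. scale_ell2 (c i) (e i)) (e j) = (if j \<in> I then c j else 0)"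
proof -
  have "ell2_inner (\<Sum>i\<in>I. scale_ell2 (c i) (e i)) (e j) = (\<Sum>i\<in>I. c i * (if i = j then 1 else 0))"
    using assms(1)
    by (simp add: linear_sum[OF bounded_linear.linear[OF bounded_linear_ell2_inner_left]]
        ell2_inner_scale_left orthonormal_def)
  also have "\<dots> = (if j \<in> I then c j else 0)"
    using assms(2) by (simp add: if_distrib[of "\<lambda>x. _ * x"] cong: if_cong)
  finally show ?thesis .
qed

lemma ell2_norm_eq_1: "ell2_inner f f = 1 \<Longrightarrow> norm f = 1"
proof -
  assume "ell2_inner f f = 1"
  then have "(of_real ((norm f)\<^sup>2) :: 'a) = of_real 1" by (simp add: ell2_inner_self)
  then have "(norm f)\<^sup>2 = 1" by (simp only: of_real_eq_iff)
  then show "norm f = 1" by (metis norm_ge_zero real_sqrt_one real_sqrt_abs abs_of_nonneg)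
qed

lemma orthonormal_norm: "orthonormal e \<Longrightarrow> norm (e n) = 1"
  by (rule ell2_norm_eq_1) (simp add: orthonormal_def)

lemma orthonormal_finite_pythagoras:
  assumes "orthonormal e" "finite I"
  shows "(norm (\<Sum>i\<in>I. scale_ell2 (c i) (e i)))\<^sup>2 = (\<Sum>i\<in>I. (norm (c i))\<^sup>2)"
  using assms(2)
proof induction
  case (insert j I)
  have "ell2_inner (\<Sum>i\<in>I. scale_ell2 (c i) (e i)) (e j) = 0"
    using orthonormal_finite_inner[OF assms(1) insert(1)] insert(2) by simp
  then have "ell2_inner (scale_ell2 (c j) (e j)) (\<Sum>i\<in>I. scale_ell2 (c i) (e i)) = 0"
    by (metis conjugate_ell2_inner conjugate_simps(1) ell2_inner_scale_left mult_zero_right)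
  from ell2_pythagoras[OF this] show ?case
    using insert orthonormal_norm[OF assms(1)] by (simp add: norm_scale_ell2 power_mult_distrib)
qed simp

lemma summable_ell2_lincomb:
  assumes "orthonormal e"
  shows "summable (\<lambda>n. scale_ell2 (ell2_nth f n) (e n))"
  unfolding summable_Cauchy
proof (intro allI impI)
  fix r :: real assume "r > 0"
  then obtain N where N: "\<And>m n. m \<ge> N \<Longrightarrow> norm (\<Sum>i\<in>{m..<n}. (norm (ell2_nth f i))\<^sup>2) < r\<^sup>2"
    using summable_ell2_nth[of f] unfolding summable_Cauchy by (meson zero_less_power)
  show "\<exists>N. \<forall>m\<ge>N. \<forall>n. norm (\<Sum>i\<in>{m..<n}. scale_ell2 (ell2_nth f i) (e i)) < r"
  proof (intro exI[of _ N] allI impI)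
    fix m n assume "m \<ge> N"
    then have "(norm (\<Sum>i\<in>{m..<n}. scale_ell2 (ell2_nth f i) (e i)))\<^sup>2 < r\<^sup>2"
      using N[of m n] by (simp add: orthonormal_finite_pythagoras[OF assms] sum_nonneg)
    then show "norm (\<Sum>i\<in>{m..<n}. scale_ell2 (ell2_nth f i) (e i)) < r"
      using \<open>r > 0\<close> power2_less_imp_less by fastforce
  qed
qed

lemma ell2_lincomb_LIMSEQ:
  assumes "orthonormal e"
  shows "(\<lambda>n. \<Sum>i<n. scale_ell2 (ell2_nth f i) (e i)) \<longlonglongrightarrow> ell2_lincomb e f"
  unfolding ell2_lincomb_def by (rule summable_LIMSEQ[OF summable_ell2_lincomb[OF assms]])

lemma ell2_lincomb_add:
  assumes "orthonormal e"
  shows "ell2_lincomb e (f + g) = ell2_lincomb e f + ell2_lincomb e g"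
  unfolding ell2_lincomb_def
  by (simp add: plus_ell2.rep_eq scale_ell2_algebra suminf_add summable_ell2_lincomb[OF assms])

lemma ell2_lincomb_scale:
  assumes "orthonormal e"
  shows "ell2_lincomb e (scale_ell2 c f) = scale_ell2 c (ell2_lincomb e f)"
  unfolding ell2_lincomb_def
    bounded_linear.suminf[OF bounded_linear_scale_ell2 summable_ell2_lincomb[OF assms]]
  by (simp add: scale_ell2.rep_eq scale_ell2_algebra)

lemma norm_ell2_lincomb:
  assumes "orthonormal e"
  shows "norm (ell2_lincomb e f) = norm f"
proof -
  have "(\<lambda>n. \<Sum>i<n. (norm (ell2_nth f i))\<^sup>2) \<longlonglongrightarrow> (norm (ell2_lincomb e f))\<^sup>2"
    using tendsto_power[OF tendsto_norm[OF ell2_lincomb_LIMSEQ[OF assms, of f]], of 2]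
    by (simp add: orthonormal_finite_pythagoras[OF assms])
  moreover have "(\<lambda>n. \<Sum>i<n. (norm (ell2_nth f i))\<^sup>2) \<longlonglongrightarrow> (norm f)\<^sup>2"
    unfolding norm_ell2_sq by (rule summable_LIMSEQ[OF summable_ell2_nth])
  ultimately have "(norm (ell2_lincomb e f))\<^sup>2 = (norm f)\<^sup>2" by (rule LIMSEQ_unique)
  then show ?thesis by simp
qed

lemma ell2_inner_lincomb:
  assumes "orthonormal e"
  shows "ell2_inner (ell2_lincomb e f) (e j) = ell2_nth f j"
proof (rule LIMSEQ_unique)
  show "(\<lambda>n. ell2_inner (\<Sum>i<n. scale_ell2 (ell2_nth f i) (e i)) (e j))
          \<longlonglongrightarrow> ell2_inner (ell2_lincomb e f) (e j)"
    by (rule bounded_linear.tendsto[OF bounded_linear_ell2_inner_left ell2_lincomb_LIMSEQ[OF assms]])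
  show "(\<lambda>n. ell2_inner (\<Sum>i<n. scale_ell2 (ell2_nth f i) (e i)) (e j)) \<longlonglongrightarrow> ell2_nth f j"
  proof (rule tendsto_eventually)
    show "\<forall>\<^sub>F n in sequentially. ell2_inner (\<Sum>i<n. scale_ell2 (ell2_nth f i) (e i)) (e j) = ell2_nth f j"
      using eventually_gt_at_top[of j]
      by eventually_elim (simp add: orthonormal_finite_inner[OF assms])
  qed
qed

lemma ell2_inner_lincomb_eq_0:
  assumes "orthonormal e" "\<And>n. ell2_inner h (e n) = 0"
  shows "ell2_inner h (ell2_lincomb e f) = 0"
proof (rule LIMSEQ_unique)
  show "(\<lambda>n. ell2_inner h (\<Sum>i<n. scale_ell2 (ell2_nth f i) (e i))) \<longlonglongrightarrow> ell2_inner h (ell2_lincomb e f)"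
    by (rule bounded_linear.tendsto[OF bounded_linear_ell2_inner_right ell2_lincomb_LIMSEQ[OF assms(1)]])
  show "(\<lambda>n. ell2_inner h (\<Sum>i<n. scale_ell2 (ell2_nth f i) (e i))) \<longlonglongrightarrow> 0"
    by (simp add: linear_sum[OF bounded_linear.linear[OF bounded_linear_ell2_inner_right]]
        ell2_inner_scale_right assms(2))
qed

lemma ell2_lincomb_in_closed_subspace:
  assumes "orthonormal e" "L.subspace V" "closed V" "range e \<subseteq> V"
  shows "ell2_lincomb e f \<in> V"
  by (rule closed_sequentially[OF assms(3) _ ell2_lincomb_LIMSEQ[OF assms(1)]])
     (use assms in \<open>auto intro!: L.subspace_sum L.subspace_scale\<close>)

text \<open>The coefficients of the projection are the Fourier coefficients of \<open>h\<close>; by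
Bessel's inequality they are square summable.\<close>

lemma orthonormal_projection:
  fixes h :: "'k::conj_field ell2"
  assumes e: "orthonormal e"
  obtains f where "\<And>n. ell2_inner (h - ell2_lincomb e f) (e n) = 0"
proof -
  define c where "c n = ell2_inner h (e n)" for n
  have "(\<Sum>n<N. (norm (c n))\<^sup>2) \<le> (norm h)\<^sup>2" for N
  proof -
    define p where "p = (\<Sum>n<N. scale_ell2 (c n) (e n))"
    have hp: "ell2_inner (h - p) (e n) = 0" if "n < N" for n
      using that by (simp add: p_def ell2_inner_diff_left orthonormal_finite_inner[OF e] c_def)
    have "ell2_inner (h - p) p = 0"
      unfolding p_def
      by (simp add: linear_sum[OF bounded_linear.linear[OF bounded_linear_ell2_inner_right]]
          ell2_inner_scale_right) (simp add: hp p_def[symmetric])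
    from ell2_pythagoras[OF this] have "(norm p)\<^sup>2 \<le> (norm h)\<^sup>2" by simp
    then show ?thesis by (simp add: p_def orthonormal_finite_pythagoras[OF e])
  qed
  then have "summable (\<lambda>n. (norm (c n))\<^sup>2)"
    by (intro summableI_nonneg_bounded) auto
  then have "ell2_nth (Abs_ell2 c) = c" by (simp add: Abs_ell2_inverse)
  then have "ell2_inner (h - ell2_lincomb e (Abs_ell2 c)) (e n) = 0" for n
    by (simp add: ell2_inner_diff_left ell2_inner_lincomb[OF e] c_def)
  then show ?thesis by (rule that)
qed

text \<open>Truncate a sequence where its tail is small, then replace the remaining entries by elements
of a countable dense set of scalars: what is left is indexed by finite lists over a countable
set.\<close>

lemma ell2_countable_dense:
  obtains D :: "'k::conj_field ell2 set" where "countable D" "\<And>x r. r > 0 \<Longrightarrow> \<exists>d\<in>D. norm (x - d) < r"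
proof -
  obtain Q :: "'k set" where Q: "countable Q" "\<And>X. open X \<Longrightarrow> X \<noteq> {} \<Longrightarrow> \<exists>d\<in>Q. d \<in> X"
    using countable_dense_exists by (metis (no_types, lifting))
  define pad :: "'k list \<Rightarrow> 'k ell2"
    where "pad l = Abs_ell2 (\<lambda>i. if i < length l then l ! i else 0)" for l
  have pad: "ell2_nth (pad l) = (\<lambda>i. if i < length l then l ! i else 0)" for l
  proof -
    have "summable (\<lambda>i. (norm (if i < length l then l ! i else 0))\<^sup>2)"
      by (rule summable_finite[of "{..<length l}"]) auto
    then show ?thesis unfolding pad_def by (subst Abs_ell2_inverse) auto
  qed
  have "\<exists>d\<in>pad ` lists Q. norm (x - d) < r" if r: "r > 0" for x r
  proof -
    have "(\<lambda>N. (norm x)\<^sup>2 - (\<Sum>i<N. (norm (ell2_nth x i))\<^sup>2)) \<longlonglongrightarrow> (norm x)\<^sup>2 - (norm x)\<^sup>2"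
      unfolding norm_ell2_sq by (intro tendsto_intros summable_LIMSEQ summable_ell2_nth)
    then have "\<forall>\<^sub>F N in sequentially. (norm x)\<^sup>2 - (\<Sum>i<N. (norm (ell2_nth x i))\<^sup>2) < r\<^sup>2 / 2"
      using r by (intro order_tendstoD(2)) auto
    then obtain N where N: "(norm x)\<^sup>2 - (\<Sum>i<N. (norm (ell2_nth x i))\<^sup>2) < r\<^sup>2 / 2"
      by (auto simp: eventually_sequentially)
    \<comment> \<open>The tail and the first \<open>N\<close> entries may each contribute \<open>r\<^sup>2 / 2\<close> to the squared distance.\<close>
    define \<delta> where "\<delta> = sqrt (r\<^sup>2 / 2 / Suc N)"
    have "\<delta> > 0" using r by (simp add: \<delta>_def)
    have "\<exists>q. q \<in> Q \<and> norm (ell2_nth x i - q) < \<delta>" for i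
      using Q(2)[of "ball (ell2_nth x i) \<delta>"] \<open>\<delta> > 0\<close> by (auto simp: dist_norm)
    then obtain q where q: "\<And>i. q i \<in> Q" "\<And>i. norm (ell2_nth x i - q i) < \<delta>" by metis
    define d where "d = pad (map q [0..<N])"
    have d: "ell2_nth d i = (if i < N then q i else 0)" for i
      by (simp add: d_def pad)
    have "(norm (x - d))\<^sup>2 = (\<Sum>i. (norm (ell2_nth x (i + N)))\<^sup>2) + (\<Sum>i<N. (norm (ell2_nth x i - q i))\<^sup>2)"
      unfolding norm_ell2_sq
      by (subst suminf_split_initial_segment[OF summable_ell2_nth, of _ N])
         (simp add: minus_ell2.rep_eq d)
    also have "(\<Sum>i. (norm (ell2_nth x (i + N)))\<^sup>2) = (norm x)\<^sup>2 - (\<Sum>i<N. (norm (ell2_nth x i))\<^sup>2)"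
      unfolding norm_ell2_sq
      by (subst suminf_split_initial_segment[OF summable_ell2_nth, of _ N]) simp
    also have "(\<Sum>i<N. (norm (ell2_nth x i - q i))\<^sup>2) \<le> (\<Sum>i<N. \<delta>\<^sup>2)"
      using q(2) by (intro sum_mono power_mono) (auto intro: less_imp_le)
    also have "(\<Sum>i<N. \<delta>\<^sup>2) \<le> r\<^sup>2 / 2"
      using r by (simp add: \<delta>_def field_simps)
    finally have "(norm (x - d))\<^sup>2 < r\<^sup>2" using N by simp
    then have "norm (x - d) < r" using r by (auto intro: power2_less_imp_less)
    moreover have "d \<in> pad ` lists Q" unfolding d_def using q(1) by (intro imageI) (auto simp: lists_eq_set)
    ultimately show ?thesis by blast
  qed
  moreover have "countable (pad ` lists Q)" using Q(1) by simp
  ultimately show thesis using that by blast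
qed

text \<open>Take a maximal orthonormal subset \<open>S\<close> of \<open>V\<close>, by Zorn's lemma.
Normalizing a vector of \<open>V\<close> orthogonal to \<open>S\<close> would enlarge \<open>S\<close>.
If \<open>S\<close> were finite, subtracting projections would show that \<open>S\<close> spans
\<open>V\<close>, so \<open>S\<close> is infinite. It is countable because its points are at distance at
least \<open>1\<close> from each other in a separable space.\<close>

lemma complete_orthonormal_sequence_exists:
  fixes V :: "'k::conj_field ell2 set"
  assumes V: "L.subspace V" "L.infinite_dimensional V"
  obtains e where "orthonormal e" "range e \<subseteq> V"
    "\<And>v. v \<in> V \<Longrightarrow> (\<And>n. ell2_inner v (e n) = 0) \<Longrightarrow> v = 0"
proof -
  define on where "on S \<longleftrightarrow> S \<subseteq> V \<and> (\<forall>x\<in>S. \<forall>y\<in>S. ell2_inner x y = (if x = y then 1 else 0))" for S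
  have "\<exists>S\<in>{S. on S}. \<forall>T\<in>{S. on S}. S \<subseteq> T \<longrightarrow> T = S"
  proof (rule subset_Zorn')
    fix C assume C: "subset.chain {S. on S} C"
    have "ell2_inner x y = (if x = y then 1 else 0)" if xy: "x \<in> \<Union>C" "y \<in> \<Union>C" for x y
    proof -
      from xy obtain S T where "S \<in> C" "T \<in> C" "x \<in> S" "y \<in> T" by blast
      moreover have "S \<subseteq> T \<or> T \<subseteq> S"
        using C \<open>S \<in> C\<close> \<open>T \<in> C\<close> unfolding subset.chain_def by blast
      ultimately obtain U where "U \<in> C" "x \<in> U" "y \<in> U" by blast
      then show ?thesis using C unfolding subset.chain_def on_def by blast
    qed
    moreover have "\<Union>C \<subseteq> V" using C unfolding subset.chain_def on_def by blast
    ultimately show "\<Union>C \<in> {S. on S}" by (simp add: on_def)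
  qed
  then obtain S where S: "on S" and max: "\<And>T. on T \<Longrightarrow> S \<subseteq> T \<Longrightarrow> T = S" by blast
  have ip: "ell2_inner x y = (if x = y then 1 else 0)" if "x \<in> S" "y \<in> S" for x y
    using S that unfolding on_def by blast
  have SV: "S \<subseteq> V" using S by (simp add: on_def)
  have complete: "v = 0" if v: "v \<in> V" "\<And>x. x \<in> S \<Longrightarrow> ell2_inner v x = 0" for v
  proof (rule ccontr)
    assume "v \<noteq> 0"
    define w where "w = scale_ell2 (of_real (1 / norm v)) v"
    have ww: "ell2_inner w w = 1"
      using \<open>v \<noteq> 0\<close> by (simp add: ell2_inner_self w_def norm_scale_ell2 norm_divide)
    have wx: "ell2_inner w x = 0" "ell2_inner x w = 0" if "x \<in> S" for x
    proof -
      show "ell2_inner w x = 0" using v(2)[OF that] by (simp add: w_def ell2_inner_scale_left)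
      then show "ell2_inner x w = 0" by (metis conjugate_ell2_inner conjugate_simps(1))
    qed
    have "w \<in> V" using v(1) V(1) by (simp add: w_def L.subspace_scale)
    then have "on (insert w S)" using S wx ww unfolding on_def by auto
    then have "w \<in> S" using max by blast
    then show False using wx ww by force
  qed
  have "infinite S"
  proof
    assume fin: "finite S"
    have "V \<subseteq> L.span S"
    proof
      fix v assume v: "v \<in> V"
      define p where "p = (\<Sum>x\<in>S. scale_ell2 (ell2_inner v x) x)"
      have p: "p \<in> L.span S" unfolding p_def
        by (intro L.span_sum L.span_scale L.span_base)
      then have "p \<in> V" using SV V(1) L.span_minimal by blast
      have "ell2_inner p y = ell2_inner v y" if "y \<in> S" for y
      proof -
        have "ell2_inner p y = (\<Sum>x\<in>S. ell2_inner v x * (if x = y then 1 else 0))"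
          using ip that
          by (simp add: p_def linear_sum[OF bounded_linear.linear[OF bounded_linear_ell2_inner_left]]
              ell2_inner_scale_left)
        also have "\<dots> = ell2_inner v y"
          using fin that by (simp add: if_distrib[of "\<lambda>x. _ * x"] cong: if_cong)
        finally show ?thesis .
      qed
      then have "v - p = 0"
        using v \<open>p \<in> V\<close> V(1) by (intro complete) (auto simp: ell2_inner_diff_left L.subspace_diff)
      then show "v \<in> L.span S" using p by simp
    qed
    moreover have "L.span S \<subseteq> V" using SV V(1) by (rule L.span_minimal)
    ultimately show False using V(2) fin unfolding L.infinite_dimensional_def by blast
  qed
  have "countable S"
  proof -
    obtain D :: "'k ell2 set" where D: "countable D" "\<And>x r. r > 0 \<Longrightarrow> \<exists>d\<in>D. norm (x - d) < r"
      by (rule ell2_countable_dense) blast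
    have "\<exists>d. d \<in> D \<and> norm (x - d) < 1 / 2" for x using D(2)[of "1 / 2" x] by auto
    then obtain q where q: "\<And>x. q x \<in> D" "\<And>x. norm (x - q x) < 1 / 2" by metis
    have "inj_on q S"
    proof (rule inj_onI, rule ccontr)
      fix x y assume xy: "x \<in> S" "y \<in> S" "q x = q y" "x \<noteq> y"
      have "norm (x - y) \<le> norm (x - q x) + norm (y - q y)"
        using norm_triangle_ineq4[of "x - q x" "y - q y"] xy(3) by simp
      then have "norm (x - y) < 1" using q(2)[of x] q(2)[of y] by linarith
      have "ell2_inner (x - y) x = 1"
        using ip[OF xy(1) xy(1)] ip[OF xy(2) xy(1)] xy(4) by (simp add: ell2_inner_diff_left)
      then have "1 \<le> norm (x - y) * norm x"
        using norm_ell2_inner_le[of "x - y" x] by simp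
      moreover have "norm x = 1" using ip[OF xy(1) xy(1)] by (intro ell2_norm_eq_1) simp
      ultimately show False using \<open>norm (x - y) < 1\<close> by simp
    qed
    moreover have "countable (q ` S)" using D(1) q(1) by (metis countable_subset image_subsetI)
    ultimately show ?thesis by (rule countable_image_inj_on[rotated])
  qed
  define e where "e = from_nat_into S"
  have e: "bij_betw e UNIV S"
    unfolding e_def by (rule bij_betw_from_nat_into[OF \<open>countable S\<close> \<open>infinite S\<close>])
  show thesis
  proof
    show "orthonormal e"
      using ip e unfolding orthonormal_def bij_betw_def by (auto simp: inj_def)
    show "range e \<subseteq> V" using e SV by (auto simp: bij_betw_def)
    show "v = 0" if "v \<in> V" "\<And>n. ell2_inner v (e n) = 0" for v
      using e by (intro complete that(1)) (metis bij_betw_imp_surj_on imageE that(2))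
  qed
qed

text \<open>This is the uniqueness of the separable infinite-dimensional Hilbert space. Closedness puts
the projection of a vector of \<open>V\<close> inside \<open>V\<close>, and then completeness of the
sequence makes the residual vanish.\<close>

lemma closed_subspace_eq_range_lincomb:
  fixes V :: "'k::conj_field ell2 set"
  assumes V: "L.subspace V" "closed V" "L.infinite_dimensional V"
  obtains e where "orthonormal e" "range (ell2_lincomb e) = V"
proof -
  obtain e where e: "orthonormal e" "range e \<subseteq> V"
    and complete: "\<And>v. v \<in> V \<Longrightarrow> (\<And>n. ell2_inner v (e n) = 0) \<Longrightarrow> v = 0"
    using complete_orthonormal_sequence_exists[OF V(1,3)] by metis
  have inV: "ell2_lincomb e f \<in> V" for f
    by (rule ell2_lincomb_in_closed_subspace[OF e(1) V(1,2) e(2)])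
  have "v \<in> range (ell2_lincomb e)" if v: "v \<in> V" for v
  proof -
    obtain f where f: "\<And>n. ell2_inner (v - ell2_lincomb e f) (e n) = 0"
      using orthonormal_projection[OF e(1)] by metis
    have "v - ell2_lincomb e f = 0"
      using complete[OF L.subspace_diff[OF V(1) v inV] f] .
    then show ?thesis by simp
  qed
  then show thesis using that e(1) inV by blast
qed

section \<open>The von Neumann--Jordan constant and almost isometric embeddings\<close>

text \<open>The von Neumann--Jordan constant measures the failure of the parallelogram law: it is at
least \<open>1\<close> on a nonzero space, and equal to \<open>1\<close> exactly if the norm comes from
an inner product. The quotient at \<open>x = y = 0\<close> is \<open>0 / 0 = 0\<close>, below all the
others.\<close>

definition jordan_neumann :: "'a::real_normed_vector set \<Rightarrow> real"
  where "jordan_neumann Y =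
    (SUP (x, y)\<in>Y \<times> Y. ((norm (x + y))\<^sup>2 + (norm (x - y))\<^sup>2) / (2 * ((norm x)\<^sup>2 + (norm y)\<^sup>2)))"

lemma sum_norm_sq_pos: "\<not> (x = 0 \<and> y = 0) \<Longrightarrow> 0 < 2 * ((norm x)\<^sup>2 + (norm y)\<^sup>2)"
  for x y :: "'a::real_normed_vector"
  by (auto intro: add_pos_nonneg add_nonneg_pos)

lemma jordan_neumann_bdd_above:
  "bdd_above ((\<lambda>(x, y). ((norm (x + y))\<^sup>2 + (norm (x - y))\<^sup>2) / (2 * ((norm x)\<^sup>2 + (norm y)\<^sup>2))) ` (Y \<times> Y))"
proof (rule bdd_aboveI2[where M = 2], clarify)
  fix x y :: 'a
  have "(norm (x + y))\<^sup>2 \<le> (norm x + norm y)\<^sup>2" "(norm (x - y))\<^sup>2 \<le> (norm x + norm y)\<^sup>2"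
    by (intro power_mono norm_triangle_ineq norm_triangle_ineq4; simp)+
  then have "(norm (x + y))\<^sup>2 + (norm (x - y))\<^sup>2 \<le> 2 * (2 * ((norm x)\<^sup>2 + (norm y)\<^sup>2))"
    using sum_squares_bound[of "norm x" "norm y"] by (simp add: power2_sum)
  then show "((norm (x + y))\<^sup>2 + (norm (x - y))\<^sup>2) / (2 * ((norm x)\<^sup>2 + (norm y)\<^sup>2)) \<le> 2"
    using pos_divide_le_eq[OF sum_norm_sq_pos[of x y]] by (cases "x = 0 \<and> y = 0") auto
qed

lemma jordan_neumann_nonneg:
  assumes "Y \<noteq> {}"
  shows "0 \<le> jordan_neumann Y"
proof -
  obtain x where x: "x \<in> Y" using assms by blast
  show ?thesis
    unfolding jordan_neumann_def
    by (rule cSUP_upper2[OF jordan_neumann_bdd_above, of "(x, x)"]) (use x in simp_all)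
qed

lemma jordan_neumann_upper:
  assumes "x \<in> Y" "y \<in> Y"
  shows "(norm (x + y))\<^sup>2 + (norm (x - y))\<^sup>2 \<le> jordan_neumann Y * (2 * ((norm x)\<^sup>2 + (norm y)\<^sup>2))"
proof (cases "x = 0 \<and> y = 0")
  case False
  then have "0 < 2 * ((norm x)\<^sup>2 + (norm y)\<^sup>2)" by (rule sum_norm_sq_pos)
  moreover have "((norm (x + y))\<^sup>2 + (norm (x - y))\<^sup>2) / (2 * ((norm x)\<^sup>2 + (norm y)\<^sup>2)) \<le> jordan_neumann Y"
    unfolding jordan_neumann_def
    using cSUP_upper[OF _ jordan_neumann_bdd_above, of "(x, y)" Y] assms by simp
  ultimately show ?thesis by (simp only: pos_divide_le_eq)
qed simp

lemma jordan_neumann_least: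
  assumes "Y \<noteq> {}" "0 \<le> c"
    and "\<And>x y. x \<in> Y \<Longrightarrow> y \<in> Y \<Longrightarrow>
      (norm (x + y))\<^sup>2 + (norm (x - y))\<^sup>2 \<le> c * (2 * ((norm x)\<^sup>2 + (norm y)\<^sup>2))"
  shows "jordan_neumann Y \<le> c"
  unfolding jordan_neumann_def
proof (rule cSUP_least, use assms(1) in blast, clarify)
  fix x y assume xy: "x \<in> Y" "y \<in> Y"
  show "((norm (x + y))\<^sup>2 + (norm (x - y))\<^sup>2) / (2 * ((norm x)\<^sup>2 + (norm y)\<^sup>2)) \<le> c"
  proof (cases "x = 0 \<and> y = 0")
    case True
    then show ?thesis using assms(2) by simp
  next
    case False
    then have "0 < 2 * ((norm x)\<^sup>2 + (norm y)\<^sup>2)" by (rule sum_norm_sq_pos)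
    then show ?thesis using assms(3)[OF xy] by (simp only: pos_divide_le_eq)
  qed
qed

context normed_space_over
begin

lemma infinite_dimensional_nonzero:
  assumes "subspace Y" "infinite_dimensional Y"
  obtains x where "x \<in> Y" "x \<noteq> 0"
proof -
  have "Y \<noteq> {0}" using assms(2) unfolding infinite_dimensional_def by (metis finite.emptyI span_empty)
  then show thesis using that subspace_0[OF assms(1)] by blast
qed

lemma onorm_on_bdd_above:
  assumes "bounded_on Y u"
  shows "bdd_above ((\<lambda>x. norm (u x) / norm x) ` Y)"
proof -
  obtain C where C: "\<And>x. x \<in> Y \<Longrightarrow> norm (u x) \<le> C * norm x"
    using assms unfolding bounded_on_def by blast
  have "norm (u x) / norm x \<le> max C 0" if "x \<in> Y" for x
    using C[OF that] by (cases "x = 0") (auto simp: divide_simps mult.commute le_max_iff_disj)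
  then show ?thesis by (rule bdd_aboveI2)
qed

lemma onorm_on_upper:
  assumes "bounded_on Y u" "x \<in> Y"
  shows "norm (u x) \<le> onorm_on Y u * norm x"
proof (cases "x = 0")
  case True
  then show ?thesis using assms unfolding bounded_on_def by auto
next
  case False
  have "norm (u x) / norm x \<le> onorm_on Y u"
    unfolding onorm_on_def using cSUP_upper[OF assms(2) onorm_on_bdd_above[OF assms(1)]] .
  then show ?thesis using False by (simp add: pos_divide_le_eq)
qed

lemma onorm_on_nonneg:
  assumes "bounded_on Y u" "x \<in> Y"
  shows "0 \<le> onorm_on Y u"
  unfolding onorm_on_def
  by (rule cSUP_upper2[OF onorm_on_bdd_above[OF assms(1)] assms(2)]) simp

lemma norm_le_onorm_on_inverse:
  assumes "u \<in> isomorphisms Y Z" "x \<in> Y"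
  shows "norm x \<le> onorm_on Z (inv_into Y u) * norm (u x)"
  using onorm_on_upper[of Z "inv_into Y u" "u x"] assms
  by (simp add: isomorphisms_def bij_betw_def inv_into_f_f) blast

lemma linear_on_minus:
  assumes "linear_on Y u" "subspace Y" "x \<in> Y" "y \<in> Y"
  shows "u (x - y) = u x - u y"
proof -
  have "u (x - y + y) = u (x - y) + u y"
    using assms subspace_diff unfolding linear_on_def by blast
  then show ?thesis by simp
qed

lemma isomorphisms_inverse:
  assumes u: "u \<in> isomorphisms Y Z" and Y: "subspace Y"
  shows "inv_into Y u \<in> isomorphisms Z Y"
    and "onorm_on Y (inv_into Z (inv_into Y u)) = onorm_on Y u"
proof -
  let ?v = "inv_into Y u"
  have lin: "linear_on Y u" and bij: "bij_betw u Y Z"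
    and bd: "bounded_on Y u" "bounded_on Z ?v"
    using u by (auto simp: isomorphisms_def)
  have Z: "Z = u ` Y" and vu: "\<And>x. x \<in> Y \<Longrightarrow> ?v (u x) = x"
    using bij by (auto simp: bij_betw_def inv_into_f_f)
  have uv: "inv_into Z ?v x = u x" if "x \<in> Y" for x
    using inv_into_inv_into_eq[OF bij that] .
  have "linear_on Z ?v"
    unfolding linear_on_def
  proof (intro conjI ballI allI)
    fix y z assume "y \<in> Z" "z \<in> Z"
    then obtain a b where ab: "a \<in> Y" "b \<in> Y" "y = u a" "z = u b" by (auto simp: Z)
    then have "u a + u b = u (a + b)" using lin by (simp add: linear_on_def)
    then show "?v (y + z) = ?v y + ?v z" using ab by (simp add: vu subspace_add[OF Y])
  next
    fix c y assume "y \<in> Z"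
    then obtain a where a: "a \<in> Y" "y = u a" by (auto simp: Z)
    then have "scale c (u a) = u (scale c a)" using lin by (simp add: linear_on_def)
    then show "?v (scale c y) = scale c (?v y)" using a by (simp add: vu subspace_scale[OF Y])
  qed
  moreover have "bounded_on Y (inv_into Z ?v)" using bd(1) uv by (simp add: bounded_on_def)
  ultimately show "?v \<in> isomorphisms Z Y"
    using bij_betw_inv_into[OF bij] bd(2) by (simp add: isomorphisms_def)
  show "onorm_on Y (inv_into Z ?v) = onorm_on Y u"
    unfolding onorm_on_def by (rule SUP_cong) (simp_all add: uv)
qed

lemma banach_mazur_commute_le:
  assumes "subspace Y"
  shows "banach_mazur Z Y \<le> banach_mazur Y Z"
  unfolding banach_mazur_def[of Y Z]
proof (rule INF_greatest)
  fix u assume u: "u \<in> isomorphisms Y Z"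
  show "banach_mazur Z Y \<le> ereal (onorm_on Y u * onorm_on Z (inv_into Y u))"
    unfolding banach_mazur_def
    by (rule INF_lower2[OF isomorphisms_inverse(1)[OF u assms]])
       (simp add: isomorphisms_inverse(2)[OF u assms] mult.commute)
qed

text \<open>The lower bound holds for every isomorphism \<open>v\<close>: a nonzero vector is recovered
from its image, so \<open>\<parallel>x\<parallel> \<le> \<parallel>v\<inverse>\<parallel>
\<parallel>v\<parallel> \<parallel>x\<parallel>\<close>.\<close>

lemma banach_mazur_isometric:
  assumes "isometric Y Z" and x: "x \<in> Y" "x \<noteq> 0"
  shows "banach_mazur Y Z = 1"
proof (rule antisym)
  obtain u where u: "linear_on Y u" "bij_betw u Y Z" "\<And>x. x \<in> Y \<Longrightarrow> norm (u x) = norm x"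
    using assms(1) unfolding isometric_def by blast
  have inv: "norm (inv_into Y u z) = norm z" if "z \<in> Z" for z
    using u(2,3) that by (metis bij_betw_def f_inv_into_f inv_into_into)
  have bd: "bounded_on Y u" "bounded_on Z (inv_into Y u)"
    unfolding bounded_on_def using u(3) inv by (intro exI[of _ 1]; simp)+
  have iso: "u \<in> isomorphisms Y Z" using u bd by (simp add: isomorphisms_def)
  have "u x \<in> Z" using u(2) x(1) by (auto simp: bij_betw_def)
  have "onorm_on Y u \<le> 1"
    unfolding onorm_on_def using x(1) u(3) by (intro cSUP_least) auto
  moreover have "onorm_on Z (inv_into Y u) \<le> 1"
    unfolding onorm_on_def using \<open>u x \<in> Z\<close> inv by (intro cSUP_least) auto
  ultimately have "onorm_on Y u * onorm_on Z (inv_into Y u) \<le> 1 * 1"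
    using onorm_on_nonneg[OF bd(2) \<open>u x \<in> Z\<close>] by (intro mult_mono) auto
  then show "banach_mazur Y Z \<le> 1"
    unfolding banach_mazur_def by (intro INF_lower2[OF iso]) (simp add: one_ereal_def)
  show "1 \<le> banach_mazur Y Z"
    unfolding banach_mazur_def
  proof (rule INF_greatest)
    fix v assume v: "v \<in> isomorphisms Y Z"
    then have bv: "bounded_on Y v" "bounded_on Z (inv_into Y v)" "v x \<in> Z"
      using x(1) by (auto simp: isomorphisms_def bij_betw_def)
    have "norm x \<le> onorm_on Z (inv_into Y v) * norm (v x)"
      by (rule norm_le_onorm_on_inverse[OF v x(1)])
    also have "\<dots> \<le> onorm_on Z (inv_into Y v) * (onorm_on Y v * norm x)"
      by (intro mult_left_mono onorm_on_upper[OF bv(1) x(1)] onorm_on_nonneg[OF bv(2,3)])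
    finally have "1 * norm x \<le> onorm_on Y v * onorm_on Z (inv_into Y v) * norm x"
      by (simp add: mult_ac)
    then have "1 \<le> onorm_on Y v * onorm_on Z (inv_into Y v)"
      using x(2) mult_right_le_imp_le by fastforce
    then show "1 \<le> ereal (onorm_on Y v * onorm_on Z (inv_into Y v))" by (simp add: one_ereal_def)
  qed
qed

lemma isometrically_embeddable_imp_almost:
  assumes "isometrically_embeddable Y Z" "x \<in> Y" "x \<noteq> 0"
  shows "almost_isometrically_embeddable Y Z"
proof -
  obtain W where W: "subspace W" "W \<subseteq> Z" "isometric Y W"
    using assms(1) unfolding isometrically_embeddable_def by blast
  have "banach_mazur Y W = 1" using banach_mazur_isometric[OF W(3) assms(2,3)] .
  then show ?thesis
    unfolding almost_isometrically_embeddable_def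
    by (intro allI impI exI[of _ W]) (simp add: W(1,2) one_ereal_def)
qed

lemma banach_mazur_1_imp_almost:
  assumes "banach_mazur Y Z \<le> 1" "subspace Z"
  shows "almost_isometrically_embeddable Y Z"
  unfolding almost_isometrically_embeddable_def
proof (intro allI impI exI[of _ Z])
  fix \<epsilon> :: real assume "\<epsilon> > 0"
  then have "(1 :: ereal) < ereal (1 + \<epsilon>)" by (simp add: one_ereal_def)
  then show "subspace Z \<and> Z \<subseteq> Z \<and> banach_mazur Y Z < ereal (1 + \<epsilon>)"
    using assms by (simp add: le_less_trans)
qed

text \<open>Transport the pair \<open>x, y\<close> by \<open>u\<close>. The two sides of the
parallelogram inequality change by the squares of the norms of \<open>u\<inverse>\<close> and of
\<open>u\<close>.\<close>

lemma jordan_neumann_isomorphism_le: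
  assumes u: "u \<in> isomorphisms Y W" and Y: "subspace Y" and W: "W \<subseteq> Z"
  shows "jordan_neumann Y \<le> (onorm_on Y u * onorm_on W (inv_into Y u))\<^sup>2 * jordan_neumann Z"
proof (rule jordan_neumann_least)
  define A B where "A = onorm_on Y u" "B = onorm_on W (inv_into Y u)"
  have lin: "linear_on Y u" and bd: "bounded_on Y u" and uZ: "\<And>x. x \<in> Y \<Longrightarrow> u x \<in> Z"
    using u W by (auto simp: isomorphisms_def bij_betw_def)
  have "0 \<in> Y" using Y by (rule subspace_0)
  show "Y \<noteq> {}" using \<open>0 \<in> Y\<close> by blast
  have J: "0 \<le> jordan_neumann Z" using jordan_neumann_nonneg uZ[OF \<open>0 \<in> Y\<close>] by blast
  then show "0 \<le> (onorm_on Y u * onorm_on W (inv_into Y u))\<^sup>2 * jordan_neumann Z" by simp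
  fix x y assume x: "x \<in> Y" and y: "y \<in> Y"
  have A: "(norm (u z))\<^sup>2 \<le> A\<^sup>2 * (norm z)\<^sup>2" if "z \<in> Y" for z
    unfolding A_B_def power_mult_distrib[symmetric]
    by (intro power_mono onorm_on_upper bd that) simp
  have B: "(norm z)\<^sup>2 \<le> B\<^sup>2 * (norm (u z))\<^sup>2" if "z \<in> Y" for z
    unfolding A_B_def power_mult_distrib[symmetric]
    by (intro power_mono norm_le_onorm_on_inverse u that) simp
  have "(norm (x + y))\<^sup>2 + (norm (x - y))\<^sup>2 \<le> B\<^sup>2 * (norm (u (x + y)))\<^sup>2 + B\<^sup>2 * (norm (u (x - y)))\<^sup>2"
    by (intro add_mono B subspace_add subspace_diff Y x y)
  also have "\<dots> = B\<^sup>2 * ((norm (u x + u y))\<^sup>2 + (norm (u x - u y))\<^sup>2)"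
    using lin x y linear_on_minus[OF lin Y x y] by (simp add: linear_on_def distrib_left)
  also have "\<dots> \<le> B\<^sup>2 * (jordan_neumann Z * (2 * ((norm (u x))\<^sup>2 + (norm (u y))\<^sup>2)))"
    by (intro mult_left_mono jordan_neumann_upper uZ x y) simp
  also have "\<dots> \<le> B\<^sup>2 * (jordan_neumann Z * (2 * (A\<^sup>2 * (norm x)\<^sup>2 + A\<^sup>2 * (norm y)\<^sup>2)))"
    by (intro mult_left_mono add_mono A x y J) simp_all
  finally show "(norm (x + y))\<^sup>2 + (norm (x - y))\<^sup>2 \<le>
      (onorm_on Y u * onorm_on W (inv_into Y u))\<^sup>2 * jordan_neumann Z * (2 * ((norm x)\<^sup>2 + (norm y)\<^sup>2))"
    unfolding A_B_def[symmetric] by (simp add: power_mult_distrib algebra_simps)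
qed

text \<open>The constant is continuous with respect to the Banach--Mazur distance and depends
monotonically on the space, so it is monotone even for almost isometric embeddings.\<close>

lemma jordan_neumann_mono_almost_embeddable:
  assumes Y: "subspace Y" and Z: "Z \<noteq> {}" and emb: "almost_isometrically_embeddable Y Z"
  shows "jordan_neumann Y \<le> jordan_neumann Z"
proof -
  have le: "jordan_neumann Y \<le> (1 + \<epsilon>)\<^sup>2 * jordan_neumann Z" if "\<epsilon> > 0" for \<epsilon>
  proof -
    obtain W where W: "subspace W" "W \<subseteq> Z" "banach_mazur Y W < ereal (1 + \<epsilon>)"
      using emb \<open>\<epsilon> > 0\<close> unfolding almost_isometrically_embeddable_def by blast
    obtain u where u: "u \<in> isomorphisms Y W"
      and lt: "onorm_on Y u * onorm_on W (inv_into Y u) < 1 + \<epsilon>"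
      using W(3) unfolding banach_mazur_def INF_less_iff by auto
    have "0 \<in> Y" "0 \<in> W" using Y W(1) by (simp_all add: subspace_0)
    then have "0 \<le> onorm_on Y u * onorm_on W (inv_into Y u)"
      using u onorm_on_nonneg unfolding isomorphisms_def by (intro mult_nonneg_nonneg) blast+
    then have "(onorm_on Y u * onorm_on W (inv_into Y u))\<^sup>2 \<le> (1 + \<epsilon>)\<^sup>2"
      using lt by (intro power_mono) auto
    then show ?thesis
      using jordan_neumann_isomorphism_le[OF u Y W(2)] jordan_neumann_nonneg[OF Z]
      by (meson mult_right_mono order_trans)
  qed
  have "(\<lambda>n. (1 + inverse (real (Suc n)))\<^sup>2 * jordan_neumann Z) \<longlonglongrightarrow> (1 + 0)\<^sup>2 * jordan_neumann Z"
    by (intro tendsto_intros LIMSEQ_inverse_real_of_nat)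
  then have "jordan_neumann Y \<le> (1 + 0)\<^sup>2 * jordan_neumann Z"
    by (rule LIMSEQ_le_const) (use le in auto)
  then show ?thesis by simp
qed

end

section \<open>Classification of the subspaces up to isometry\<close>

lemma l1sum_sel_simps [simp]:
  "l1_fst 0 = 0" "l1_snd 0 = 0"
  "l1_fst (x + y) = l1_fst x + l1_fst y" "l1_snd (x + y) = l1_snd x + l1_snd y"
  "l1_fst (x - y) = l1_fst x - l1_fst y" "l1_snd (x - y) = l1_snd x - l1_snd y"
  "l1_fst (r *\<^sub>R x) = r *\<^sub>R l1_fst x" "l1_snd (r *\<^sub>R x) = r *\<^sub>R l1_snd x"
  by (simp_all add: zero_l1sum_def plus_l1sum_def minus_l1sum_def scaleR_l1sum_def)

lemma scale_X_sel [simp]: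
  "l1_fst (scale_X c x) = c * l1_fst x" "l1_snd (scale_X c x) = scale_ell2 c (l1_snd x)"
  by (simp_all add: scale_X_def)

lemma bounded_linear_l1_fst: "bounded_linear l1_fst"
  by (rule bounded_linear_intro[where K = 1]) (auto simp: norm_l1sum_def)

lemma bounded_linear_l1_snd: "bounded_linear l1_snd"
  by (rule bounded_linear_intro[where K = 1]) (auto simp: norm_l1sum_def)

lemma bounded_linear_Oplus_0: "bounded_linear (\<lambda>f. 0 \<oplus>\<^sub>1 f)"
  by (rule bounded_linear_intro[where K = 1])
     (auto simp: norm_l1sum_def intro!: l1sum.expand)

lift_definition ell2_cons :: "'a::real_normed_vector \<Rightarrow> 'a ell2 \<Rightarrow> 'a ell2"
  is "\<lambda>a f. case_nat a f"
  by (subst summable_Suc_iff[symmetric]) simp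

lift_definition ell2_tail :: "'a::real_normed_vector ell2 \<Rightarrow> 'a ell2"
  is "\<lambda>f n. f (Suc n)"
  by (subst (asm) summable_Suc_iff[symmetric]) simp

lemma norm_ell2_cons: "(norm (ell2_cons a f))\<^sup>2 = (norm a)\<^sup>2 + (norm f)\<^sup>2"
  unfolding norm_ell2_sq
  using suminf_split_head[OF summable_ell2_nth[of "ell2_cons a f"]] by (simp add: ell2_cons.rep_eq)

lemma norm_ell2_cons_0: "norm (ell2_cons a 0) = norm a" "norm (ell2_cons 0 f) = norm f"
  using norm_ell2_cons[of a 0] norm_ell2_cons[of 0 f] by simp_all

lemma ell2_cons_add: "ell2_cons (a + b) (f + g) = ell2_cons a f + ell2_cons b g"
  by (rule ell2_eqI) (simp add: ell2_cons.rep_eq plus_ell2.rep_eq split: nat.split)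

lemma ell2_cons_scale: "ell2_cons (c * a) (scale_ell2 c f) = scale_ell2 c (ell2_cons a f)"
  by (rule ell2_eqI) (simp add: ell2_cons.rep_eq scale_ell2.rep_eq split: nat.split)

lemma ell2_cons_nth_0_tail: "ell2_cons (ell2_nth f 0) (ell2_tail f) = f"
  by (rule ell2_eqI) (simp add: ell2_cons.rep_eq ell2_tail.rep_eq split: nat.split)

text \<open>For \<open>s \<in> [0, 1]\<close> these norms on \<open>K \<oplus> \<ell>\<^sub>2\<close>
interpolate between the Hilbert norm (\<open>s = 0\<close>) and the norm of the
\<open>\<ell>\<^sub>1\<close>-sum (\<open>s = 1\<close>). The scaling is chosen so that the vectors
\<open>a \<oplus> 0\<close> have norm \<open>\<bar>a\<bar>\<close> for all \<open>s\<close>.\<close>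

definition model_norm :: "real \<Rightarrow> 'k::conj_field X \<Rightarrow> real"
  where "model_norm s x =
    s * norm (l1_fst x) + sqrt ((1 - s)\<^sup>2 * (norm (l1_fst x))\<^sup>2 + (norm (l1_snd x))\<^sup>2)"

text \<open>The map \<open>T\<close> is an isometry onto \<open>Y\<close> from the space with the model
norm of parameter \<open>s\<close>; that space is not a type of its own, so it appears only through the
norms of the values of \<open>T\<close>.\<close>

definition profile :: "real \<Rightarrow> 'k::conj_field X set \<Rightarrow> bool"
  where "profile s Y \<longleftrightarrow> 0 \<le> s \<and> s \<le> 1 \<and>
    (\<exists>T. X.linear_on UNIV T \<and> bij_betw T UNIV Y \<and> (\<forall>x. norm (T x) = model_norm s x))"

text \<open>The square root is at least \<open>(1 - s) \<bar>a\<bar>\<close>; this bounds the mixed term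
of the square from below by \<open>2 s (1 - s) \<bar>a\<bar>\<^sup>2\<close>, and \<open>s\<^sup>2 + (1 -
s)\<^sup>2 + 2 s (1 - s) = 1\<close>.\<close>

lemma hilbert_norm_le_model_norm:
  assumes "0 \<le> s" "s \<le> 1"
  shows "(norm (l1_fst x))\<^sup>2 + (norm (l1_snd x))\<^sup>2 \<le> (model_norm s x)\<^sup>2"
proof -
  define \<alpha> \<xi> q where "\<alpha> = norm (l1_fst x)" "\<xi> = norm (l1_snd x)" "q = sqrt ((1 - s)\<^sup>2 * \<alpha>\<^sup>2 + \<xi>\<^sup>2)"
  have "sqrt (((1 - s) * \<alpha>)\<^sup>2) \<le> q"
    unfolding \<alpha>_\<xi>_q_def by (intro real_sqrt_le_mono) (simp add: power_mult_distrib)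
  then have q: "(1 - s) * \<alpha> \<le> q" using assms by (simp add: \<alpha>_\<xi>_q_def)
  have q2: "q\<^sup>2 = (1 - s)\<^sup>2 * \<alpha>\<^sup>2 + \<xi>\<^sup>2" by (simp add: \<alpha>_\<xi>_q_def)
  have "2 * (s * \<alpha>) * ((1 - s) * \<alpha>) \<le> 2 * (s * \<alpha>) * q"
    using assms q by (intro mult_left_mono) (auto simp: \<alpha>_\<xi>_q_def)
  then have "\<alpha>\<^sup>2 + \<xi>\<^sup>2 \<le> (s * \<alpha> + q)\<^sup>2"
    by (simp add: power2_sum q2) (simp add: power2_eq_square algebra_simps)
  then show ?thesis by (simp add: model_norm_def \<alpha>_\<xi>_q_def)
qed

text \<open>The Cauchy--Schwarz inequality for the two summands \<open>s \<bar>a\<bar>\<close> and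
\<open>q\<close>, with weights chosen so that equality can occur, namely at \<open>q = (2 - s)
\<bar>a\<bar>\<close>. The constant \<open>2 / (2 - s)\<close> is therefore sharp.\<close>

lemma model_norm_le_hilbert_norm:
  assumes "0 \<le> s" "s \<le> 1"
  shows "(model_norm s x)\<^sup>2 \<le> 2 / (2 - s) * ((norm (l1_fst x))\<^sup>2 + (norm (l1_snd x))\<^sup>2)"
proof -
  define \<alpha> \<xi> q where "\<alpha> = norm (l1_fst x)" "\<xi> = norm (l1_snd x)" "q = sqrt ((1 - s)\<^sup>2 * \<alpha>\<^sup>2 + \<xi>\<^sup>2)"
  have q2: "q\<^sup>2 = (1 - s)\<^sup>2 * \<alpha>\<^sup>2 + \<xi>\<^sup>2" by (simp add: \<alpha>_\<xi>_q_def)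
  have "0 \<le> s * ((2 - s) * \<alpha> - q)\<^sup>2" using assms by simp
  also have "\<dots> = 2 * (\<alpha>\<^sup>2 + (q\<^sup>2 - (1 - s)\<^sup>2 * \<alpha>\<^sup>2)) - (2 - s) * (s * \<alpha> + q)\<^sup>2"
    by (simp add: power2_eq_square algebra_simps)
  finally have "(2 - s) * (s * \<alpha> + q)\<^sup>2 \<le> 2 * (\<alpha>\<^sup>2 + \<xi>\<^sup>2)" by (simp add: q2)
  then have "(s * \<alpha> + q)\<^sup>2 \<le> 2 / (2 - s) * (\<alpha>\<^sup>2 + \<xi>\<^sup>2)"
    using assms by (simp add: field_simps)
  then show ?thesis by (simp add: model_norm_def \<alpha>_\<xi>_q_def)
qed

lemma model_norm_eq_0D:
  assumes "0 \<le> s" "s \<le> 1" "model_norm s x = 0"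
  shows "x = 0"
  using hilbert_norm_le_model_norm[OF assms(1,2), of x] assms(3)
  by (intro l1sum.expand) (auto simp: sum_power2_le_zero_iff)

lemma profileI:
  assumes "0 \<le> s" "s \<le> 1" and T: "X.linear_on UNIV T" "range T = Y" "\<And>x. norm (T x) = model_norm s x"
  shows "profile s Y"
proof -
  have "inj T"
  proof (rule injI)
    fix x y assume "T x = T y"
    then have "model_norm s (x - y) = 0"
      using X.linear_on_minus[OF T(1) X.subspace_UNIV, of x y] by (simp add: T(3)[symmetric])
    then show "x = y" using model_norm_eq_0D[OF assms(1,2)] by fastforce
  qed
  then show ?thesis using assms unfolding profile_def bij_betw_def by blast
qed

lemma isometric_if_same_profile:
  fixes Y Z :: "'k::conj_field X set"
  assumes "profile s Y" "profile s Z"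
  shows "X.isometric Y Z"
proof -
  obtain T where T: "X.linear_on UNIV T" "bij_betw T UNIV Y" "\<And>x. norm (T x) = model_norm s x"
    using assms(1) unfolding profile_def by blast
  obtain R where R: "X.linear_on UNIV R" "bij_betw R UNIV Z" "\<And>x. norm (R x) = model_norm s x"
    using assms(2) unfolding profile_def by blast
  define u where "u = R \<circ> inv T"
  have uT: "u (T x) = R x" for x
    using T(2) by (simp add: u_def bij_betw_def inv_f_f)
  have Y: "Y = range T" using T(2) by (simp add: bij_betw_def)
  have "u (T x + T y) = u (T x) + u (T y)" for x y
    using T(1) R(1) by (metis UNIV_I X.linear_on_def uT)
  moreover have "u (scale_X c (T x)) = scale_X c (u (T x))" for c x
    using T(1) R(1) by (metis UNIV_I X.linear_on_def uT)
  moreover have "bij_betw u Y Z"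
    unfolding u_def by (rule bij_betw_trans[OF bij_betw_inv_into[OF T(2)] R(2)])
  moreover have "norm (u (T x)) = norm (T x)" for x by (simp add: uT T(3) R(3))
  ultimately show ?thesis
    unfolding X.isometric_def X.linear_on_def by (intro exI[of _ u]) (auto simp: Y)
qed

text \<open>A vector \<open>w\<close> as assumed spans, together with \<open>{y \<in> Y. l1_fst y =
0}\<close>, the space \<open>Y\<close>. Two choices matter: \<open>w = 0\<close> if the first coordinate
vanishes on \<open>Y\<close>, and otherwise a vector with first coordinate \<open>1\<close>.\<close>

lemma zero_first_coordinate_slice:
  fixes Y :: "'k::conj_field X set"
  assumes Y: "Y \<in> X.subspaces" and w: "w \<in> Y" "\<And>y. y \<in> Y \<Longrightarrow> l1_fst y = l1_fst y * l1_fst w"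
  defines "V \<equiv> {f. 0 \<oplus>\<^sub>1 f \<in> Y}"
  shows "L.subspace V" "closed V" "L.infinite_dimensional V"
proof -
  have sub: "X.subspace Y" and clo: "closed Y" and inf: "X.infinite_dimensional Y"
    using Y by (auto simp: X.subspaces_def)
  have add: "0 \<oplus>\<^sub>1 (f + g) = (0 \<oplus>\<^sub>1 f) + ((0::'k) \<oplus>\<^sub>1 g)" for f g :: "'k ell2"
    by (rule l1sum.expand) simp
  have sc: "0 \<oplus>\<^sub>1 scale_ell2 c f = scale_X c (0 \<oplus>\<^sub>1 f)" for c and f :: "'k ell2"
    by (rule l1sum.expand) simp
  have zero: "0 \<oplus>\<^sub>1 0 = (0 :: 'k X)" by (rule l1sum.expand) simp
  have pre: "L.subspace {f. 0 \<oplus>\<^sub>1 f \<in> W}" if "X.subspace W" for W :: "'k X set"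
    using that unfolding L.subspace_def X.subspace_def by (auto simp: add sc zero)
  show "L.subspace V" unfolding V_def by (rule pre[OF sub])
  have "V = (\<lambda>f. 0 \<oplus>\<^sub>1 f) -` Y" by (auto simp: V_def)
  then show "closed V"
    by (simp only:) (intro continuous_closed_vimage[OF clo] linear_continuous_at[OF bounded_linear_Oplus_0])
  show "L.infinite_dimensional V"
    unfolding L.infinite_dimensional_def
  proof (rule notI, elim exE conjE)
    fix B assume B: "finite B" "L.span B = V"
    define C where "C = insert w ((\<lambda>f. 0 \<oplus>\<^sub>1 f) ` B)"
    have "B \<subseteq> {f. 0 \<oplus>\<^sub>1 f \<in> X.span C}" by (auto simp: C_def intro: X.span_base)
    then have VC: "L.span B \<subseteq> {f. 0 \<oplus>\<^sub>1 f \<in> X.span C}"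
      by (intro L.span_minimal pre) auto
    have "C \<subseteq> Y" using w(1) B(2) L.span_base by (fastforce simp: C_def V_def)
    then have "X.span C \<subseteq> Y" by (rule X.span_minimal[OF _ sub])
    moreover have "Y \<subseteq> X.span C"
    proof
      fix y assume y: "y \<in> Y"
      define z where "z = y - scale_X (l1_fst y) w"
      have "z \<in> Y" using y w(1) sub by (simp add: z_def X.subspace_diff X.subspace_scale)
      have z: "0 \<oplus>\<^sub>1 l1_snd z = z"
        by (rule l1sum.expand) (use w(2)[OF y] in \<open>simp add: z_def\<close>)
      then have "l1_snd z \<in> V" using \<open>z \<in> Y\<close> by (simp add: V_def)
      then have "z \<in> X.span C" using VC B(2) z by force
      moreover have "scale_X (l1_fst y) w \<in> X.span C"
        by (intro X.span_scale X.span_base) (simp add: C_def)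
      ultimately have "z + scale_X (l1_fst y) w \<in> X.span C" by (rule X.span_add)
      then show "y \<in> X.span C" by (simp add: z_def)
    qed
    ultimately have "X.span C = Y" by blast
    moreover have "finite C" using B(1) by (simp add: C_def)
    ultimately show False using inf unfolding X.infinite_dimensional_def by blast
  qed
qed

text \<open>If the first coordinate vanishes on \<open>Y\<close>, then \<open>Y\<close> is a Hilbert
space and \<open>s = 0\<close>. Otherwise let \<open>V\<close> be the kernel of the first coordinate on
\<open>Y\<close>, viewed in \<open>\<ell>\<^sub>2\<close>. A vector of \<open>Y\<close> with first
coordinate \<open>1\<close> can be corrected by an element of \<open>V\<close> to \<open>1 \<oplus>
h\<close> with \<open>h\<close> orthogonal to \<open>V\<close>, and by Pythagoras the vector \<open>a (1
\<oplus> h) + (0 \<oplus> v)\<close> has norm \<open>\<bar>a\<bar> + sqrt (\<bar>a\<bar>\<^sup>2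
\<parallel>h\<parallel>\<^sup>2 + \<parallel>v\<parallel>\<^sup>2)\<close>: only
\<open>\<parallel>h\<parallel>\<close> matters.\<close>

lemma profile_exists:
  fixes Y :: "'k::conj_field X set"
  assumes Y: "Y \<in> X.subspaces"
  obtains s where "profile s Y"
proof (cases "\<forall>y\<in>Y. l1_fst y = 0")
  case True
  define V where "V = {f. 0 \<oplus>\<^sub>1 f \<in> Y}"
  have sub: "X.subspace Y" using Y by (simp add: X.subspaces_def)
  have "0 \<in> Y" using sub by (simp add: X.subspace_0)
  obtain e where e: "orthonormal e" "range (ell2_lincomb e) = V"
    using closed_subspace_eq_range_lincomb zero_first_coordinate_slice[OF Y \<open>0 \<in> Y\<close>] True
    unfolding V_def by (metis mult_zero_left)
  define T where "T x = (0::'k) \<oplus>\<^sub>1 ell2_lincomb e (ell2_cons (l1_fst x) (l1_snd x))" for x :: "'k X"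
  have "profile 0 Y"
  proof (rule profileI)
    show "X.linear_on UNIV T"
      unfolding X.linear_on_def T_def
      by (auto intro!: l1sum.expand
          simp: ell2_cons_add ell2_cons_scale ell2_lincomb_add[OF e(1)] ell2_lincomb_scale[OF e(1)])
    show "norm (T x) = model_norm 0 x" for x
      using real_sqrt_unique[OF norm_ell2_cons[of "l1_fst x" "l1_snd x"]]
      by (simp add: T_def norm_l1sum_def norm_ell2_lincomb[OF e(1)] model_norm_def)
    show "range T = Y"
    proof (intro equalityI subsetI)
      fix y assume y: "y \<in> range T"
      then show "y \<in> Y" using e(2) by (auto simp: T_def V_def)
    next
      fix y assume y: "y \<in> Y"
      have eq: "0 \<oplus>\<^sub>1 l1_snd y = y" using True y by (intro l1sum.expand) simp
      then have "l1_snd y \<in> V" using y by (simp add: V_def)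
      then obtain f where f: "l1_snd y = ell2_lincomb e f" using e(2) by blast
      have "y = T (ell2_nth f 0 \<oplus>\<^sub>1 ell2_tail f)"
        using eq f by (simp add: T_def ell2_cons_nth_0_tail)
      then show "y \<in> range T" by blast
    qed
  qed simp_all
  then show thesis by (rule that)
next
  case False
  then obtain y0 where y0: "y0 \<in> Y" "l1_fst y0 \<noteq> 0" by blast
  define V where "V = {f. 0 \<oplus>\<^sub>1 f \<in> Y}"
  have sub: "X.subspace Y" using Y by (simp add: X.subspaces_def)
  define w0 where "w0 = scale_X (1 / l1_fst y0) y0"
  have w0: "w0 \<in> Y" "l1_fst w0 = 1"
    using y0 sub by (auto simp: w0_def X.subspace_scale)
  obtain e where e: "orthonormal e" "range (ell2_lincomb e) = V"
    using closed_subspace_eq_range_lincomb zero_first_coordinate_slice[OF Y w0(1)] w0(2)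
    unfolding V_def by (metis mult.right_neutral)
  obtain p where p: "\<And>n. ell2_inner (l1_snd w0 - ell2_lincomb e p) (e n) = 0"
    using orthonormal_projection[OF e(1)] by blast
  define h where "h = l1_snd w0 - ell2_lincomb e p"
  have "ell2_lincomb e p \<in> V" using e(2) by blast
  then have "w0 - (0 \<oplus>\<^sub>1 ell2_lincomb e p) \<in> Y"
    using w0(1) sub by (intro X.subspace_diff) (auto simp: V_def)
  moreover have "w0 - (0 \<oplus>\<^sub>1 ell2_lincomb e p) = 1 \<oplus>\<^sub>1 h"
    by (rule l1sum.expand) (simp add: h_def w0(2))
  ultimately have hY: "1 \<oplus>\<^sub>1 h \<in> Y" by simp
  \<comment> \<open>Dividing \<open>1 \<oplus> h\<close> by its norm gives it first coordinate \<open>s\<close> and a second coordinate of norm \<open>1 - s\<close>.\<close>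
  define s where "s = 1 / (1 + norm h)"
  have s: "0 < s" "s \<le> 1" "s * norm h = 1 - s"
  proof -
    have pos: "1 + norm h > 0" by (simp add: add_pos_nonneg)
    then show "0 < s" "s \<le> 1" by (simp_all add: s_def)
    show "s * norm h = 1 - s" using pos unfolding s_def by (simp add: divide_simps)
  qed
  define T where "T x = (of_real s * l1_fst x) \<oplus>\<^sub>1
      (scale_ell2 (of_real s * l1_fst x) h + ell2_lincomb e (l1_snd x))" for x :: "'k X"
  have "profile s Y"
  proof (rule profileI)
    show "X.linear_on UNIV T"
      unfolding X.linear_on_def T_def
      by (auto intro!: l1sum.expand simp: ell2_lincomb_add[OF e(1)] ell2_lincomb_scale[OF e(1)]
          scale_ell2_algebra(1-3) algebra_simps)
    show "norm (T x) = model_norm s x" for x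
    proof -
      have "ell2_inner (scale_ell2 (of_real s * l1_fst x) h) (ell2_lincomb e (l1_snd x)) = 0"
        using ell2_inner_lincomb_eq_0[OF e(1) p] by (simp add: ell2_inner_scale_left h_def)
      from ell2_pythagoras[OF this]
      have "(norm (l1_snd (T x)))\<^sup>2 = (1 - s)\<^sup>2 * (norm (l1_fst x))\<^sup>2 + (norm (l1_snd x))\<^sup>2"
        using s(1) by (simp add: T_def norm_ell2_lincomb[OF e(1)] norm_scale_ell2 norm_mult
            s(3)[symmetric] power_mult_distrib mult_ac)
      from real_sqrt_unique[OF this] show ?thesis
        using s(1) by (simp add: norm_l1sum_def model_norm_def T_def norm_mult)
    qed
    show "range T = Y"
    proof (intro equalityI subsetI)
      fix y assume "y \<in> range T"
      then obtain x where x: "y = T x" by blast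
      have "ell2_lincomb e (l1_snd x) \<in> V" using e(2) by blast
      then have "scale_X (of_real s * l1_fst x) (1 \<oplus>\<^sub>1 h) + (0 \<oplus>\<^sub>1 ell2_lincomb e (l1_snd x)) \<in> Y"
        using hY sub by (intro X.subspace_add X.subspace_scale) (auto simp: V_def)
      moreover have "scale_X (of_real s * l1_fst x) (1 \<oplus>\<^sub>1 h) + (0 \<oplus>\<^sub>1 ell2_lincomb e (l1_snd x)) = y"
        unfolding x T_def by (rule l1sum.expand) simp
      ultimately show "y \<in> Y" by simp
    next
      fix y assume y: "y \<in> Y"
      have "y - scale_X (l1_fst y) (1 \<oplus>\<^sub>1 h) \<in> Y"
        using y hY sub by (intro X.subspace_diff X.subspace_scale)
      moreover have "y - scale_X (l1_fst y) (1 \<oplus>\<^sub>1 h) = 0 \<oplus>\<^sub>1 (l1_snd y - scale_ell2 (l1_fst y) h)"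
        by (rule l1sum.expand) simp
      ultimately have "l1_snd y - scale_ell2 (l1_fst y) h \<in> V" by (simp add: V_def)
      then obtain f where f: "l1_snd y - scale_ell2 (l1_fst y) h = ell2_lincomb e f"
        using e(2) by blast
      have "y = T ((l1_fst y / of_real s) \<oplus>\<^sub>1 f)"
        unfolding T_def by (rule l1sum.expand) (use s(1) f[symmetric] in simp)
      then show "y \<in> range T" by blast
    qed
  qed (use s in simp_all)
  then show thesis by (rule that)
qed

text \<open>The squared model norm lies between the squared Hilbert norm \<open>?h\<close>, which
satisfies the parallelogram law, and \<open>2 / (2 - s)\<close> times \<open>?h\<close>, so the constant
is at most this factor. For the lower bound take orthogonal \<open>x\<close> and \<open>y\<close> on
which the two norms agree, but such that the factor is attained at both \<open>x + y\<close> and \<open>x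
- y\<close>.\<close>

lemma jordan_neumann_profile:
  fixes Y :: "'k::conj_field X set"
  assumes "profile s Y"
  shows "jordan_neumann Y = 2 / (2 - s)"
proof (rule antisym)
  obtain T where s: "0 \<le> s" "s \<le> 1" and T: "X.linear_on UNIV T" "bij_betw T UNIV Y"
    and N: "\<And>x. norm (T x) = model_norm s x"
    using assms unfolding profile_def by blast
  have Y: "Y = range T" using T(2) by (simp add: bij_betw_def)
  have plus: "T x + T y = T (x + y)" for x y using T(1) by (simp add: X.linear_on_def)
  have minus: "T x - T y = T (x - y)" for x y using X.linear_on_minus[OF T(1) X.subspace_UNIV, of x y] by simp
  let ?h = "\<lambda>x :: 'k X. (norm (l1_fst x))\<^sup>2 + (norm (l1_snd x))\<^sup>2"
  have par_k: "(norm (a + b))\<^sup>2 + (norm (a - b))\<^sup>2 = 2 * ((norm a)\<^sup>2 + (norm b)\<^sup>2)" for a b :: 'k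
    by (simp add: power2_norm_eq_inner inner_add inner_diff)
  have par: "?h (x + y) + ?h (x - y) = 2 * (?h x + ?h y)" for x y :: "'k X"
    using ell2_parallelogram[of "l1_snd x" "l1_snd y"] par_k[of "l1_fst x" "l1_fst y"]
    by simp
  show "jordan_neumann Y \<le> 2 / (2 - s)"
  proof (rule jordan_neumann_least)
    show "Y \<noteq> {}" "0 \<le> 2 / (2 - s)" using s by (simp_all add: Y)
    fix x y assume "x \<in> Y" "y \<in> Y"
    then obtain p q where pq: "x = T p" "y = T q" by (auto simp: Y)
    have "(model_norm s (p + q))\<^sup>2 + (model_norm s (p - q))\<^sup>2 \<le> 2 / (2 - s) * (?h (p + q) + ?h (p - q))"
      using model_norm_le_hilbert_norm[OF s, of "p + q"] model_norm_le_hilbert_norm[OF s, of "p - q"]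
      by (simp add: distrib_left)
    also have "\<dots> \<le> 2 / (2 - s) * (2 * ((model_norm s p)\<^sup>2 + (model_norm s q)\<^sup>2))"
      unfolding par
      using hilbert_norm_le_model_norm[OF s, of p] hilbert_norm_le_model_norm[OF s, of q] s
      by (intro mult_left_mono) auto
    finally show "(norm (x + y))\<^sup>2 + (norm (x - y))\<^sup>2 \<le> 2 / (2 - s) * (2 * ((norm x)\<^sup>2 + (norm y)\<^sup>2))"
      by (simp add: pq plus minus N)
  qed
  \<comment> \<open>On \<open>\<plusminus>\<alpha> \<oplus> c\<close> the square root equals \<open>(2 - s) \<alpha>\<close>, the case of equality in the upper estimate of the
    model norm; the scaling makes \<open>\<alpha>\<^sup>2 + c\<^sup>2 = 1\<close>.\<close>
  define \<alpha> c where "\<alpha> = 1 / sqrt (4 - 2 * s)" "c = sqrt (3 - 2 * s) * \<alpha>"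
  have pos: "\<alpha> > 0" "c \<ge> 0" using s by (simp_all add: \<alpha>_c_def)
  have \<alpha>2: "\<alpha>\<^sup>2 = 1 / (4 - 2 * s)" using s by (simp add: \<alpha>_c_def power_divide)
  have c2: "c\<^sup>2 = (3 - 2 * s) * \<alpha>\<^sup>2" using s by (simp add: \<alpha>_c_def power_mult_distrib power_divide)
  have "sqrt ((1 - s)\<^sup>2 * \<alpha>\<^sup>2 + c\<^sup>2) = sqrt (((2 - s) * \<alpha>)\<^sup>2)"
    unfolding c2 by (rule arg_cong[where f = sqrt]) (simp add: power2_eq_square algebra_simps)
  also have "\<dots> = (2 - s) * \<alpha>" using s pos by simp
  finally have root: "sqrt ((1 - s)\<^sup>2 * \<alpha>\<^sup>2 + c\<^sup>2) = (2 - s) * \<alpha>" .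
  have val: "model_norm s (of_real a \<oplus>\<^sub>1 ell2_cons (of_real b) 0) = 2 * \<alpha>"
    if "\<bar>a\<bar> = \<alpha>" "\<bar>b\<bar> = c" for a b
    using that root by (simp add: model_norm_def norm_ell2_cons_0 algebra_simps)
  define x y :: "'k X" where "x = (0::'k) \<oplus>\<^sub>1 ell2_cons (of_real c) 0" "y = (of_real \<alpha> :: 'k) \<oplus>\<^sub>1 0"
  have "norm (T (x + y)) = 2 * \<alpha>"
  proof -
    have "x + y = of_real \<alpha> \<oplus>\<^sub>1 ell2_cons (of_real c) 0"
      by (rule l1sum.expand) (simp add: x_y_def)
    then show ?thesis using pos by (simp add: N val)
  qed
  moreover have "norm (T (x - y)) = 2 * \<alpha>"
  proof -
    have "x - y = of_real (- \<alpha>) \<oplus>\<^sub>1 ell2_cons (of_real c) 0"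
      by (rule l1sum.expand) (simp add: x_y_def)
    then show ?thesis using pos by (simp only: N val)
  qed
  moreover have "norm (T x) = c"
    using pos by (simp add: N model_norm_def x_y_def norm_ell2_cons_0)
  moreover have "norm (T y) = \<alpha>"
    using pos s by (simp add: N model_norm_def x_y_def real_sqrt_mult algebra_simps)
  ultimately have "2 * (2 * \<alpha>)\<^sup>2 \<le> jordan_neumann Y * (2 * (c\<^sup>2 + \<alpha>\<^sup>2))"
    using jordan_neumann_upper[of "T x" Y "T y"] by (simp add: plus minus Y)
  moreover have "c\<^sup>2 + \<alpha>\<^sup>2 = 1" using s by (simp add: c2 \<alpha>2 field_simps)
  ultimately have "4 * \<alpha>\<^sup>2 \<le> jordan_neumann Y" by (simp add: power_mult_distrib)
  moreover have "4 * \<alpha>\<^sup>2 = 2 / (2 - s)" using s by (simp add: \<alpha>2 field_simps)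
  ultimately show "2 / (2 - s) \<le> jordan_neumann Y" by simp
qed

section \<open>The four relations coincide\<close>

text \<open>The map \<open>s \<mapsto> 2 / (2 - s)\<close> is injective on \<open>[0, 1]\<close>, so the
constant determines the profile, hence the isometry type.\<close>

lemma isometric_if_jordan_neumann_eq:
  fixes Y Z :: "'k::conj_field X set"
  assumes "Y \<in> X.subspaces" "Z \<in> X.subspaces" "jordan_neumann Y = jordan_neumann Z"
  shows "X.isometric Y Z"
proof -
  obtain s where s: "profile s Y" using profile_exists[OF assms(1)] .
  obtain t where t: "profile t Z" using profile_exists[OF assms(2)] .
  have "2 / (2 - s) = 2 / (2 - t)"
    using assms(3) jordan_neumann_profile[OF s] jordan_neumann_profile[OF t] by simp
  moreover have "s \<le> 1" "t \<le> 1" using s t by (auto simp: profile_def)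
  ultimately have "s = t" by (simp add: field_simps)
  then show ?thesis using isometric_if_same_profile s t by blast
qed

definition jordan_neumann_rel :: "('k::conj_field X set \<times> 'k X set) set"
  where "jordan_neumann_rel = {(Y, Z) \<in> X.subspaces \<times> X.subspaces. jordan_neumann Y = jordan_neumann Z}"

text \<open>Equal constants imply isometry; isometry implies each of the other relations; and each of
these implies almost isometric bi-embeddability, under which the constant is invariant.\<close>

lemma relations_eq_jordan_neumann_rel:
  "X.isometry_rel = (jordan_neumann_rel :: ('k::conj_field X set \<times> 'k X set) set)"
  "X.distance_one_rel = (jordan_neumann_rel :: ('k X set \<times> 'k X set) set)"
  "X.isometric_biembeddability_rel = (jordan_neumann_rel :: ('k X set \<times> 'k X set) set)"
  "X.almost_isometric_biembeddability_rel = (jordan_neumann_rel :: ('k X set \<times> 'k X set) set)"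
proof -
  have D: "X.subspace Y" "Y \<noteq> {}" "\<exists>x\<in>Y. x \<noteq> 0" if "Y \<in> X.subspaces" for Y :: "'k X set"
  proof -
    show sub: "X.subspace Y" using that by (simp add: X.subspaces_def)
    then show "Y \<noteq> {}" using X.subspace_0 by blast
    have "X.infinite_dimensional Y" using that by (simp add: X.subspaces_def)
    then show "\<exists>x\<in>Y. x \<noteq> 0" by (rule X.infinite_dimensional_nonzero[OF sub]) blast
  qed
  have emb: "X.isometrically_embeddable Y Z" if "X.isometric Y Z" "Z \<in> X.subspaces" for Y Z :: "'k X set"
    using that D(1) unfolding X.isometrically_embeddable_def by blast
  have almost: "X.almost_isometrically_embeddable Y Z"
    if "X.isometrically_embeddable Y Z" "Y \<in> X.subspaces" for Y Z :: "'k X set"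
    using that D(3) X.isometrically_embeddable_imp_almost by blast
  have bi: "jordan_neumann Y = jordan_neumann Z"
    if "Y \<in> X.subspaces" "Z \<in> X.subspaces"
      "X.almost_isometrically_embeddable Y Z" "X.almost_isometrically_embeddable Z Y" for Y Z :: "'k X set"
    using that D by (intro antisym X.jordan_neumann_mono_almost_embeddable)
  have one: "X.almost_isometrically_embeddable Y Z \<and> X.almost_isometrically_embeddable Z Y"
    if "X.banach_mazur Y Z = 1" "Y \<in> X.subspaces" "Z \<in> X.subspaces" for Y Z :: "'k X set"
    using that D(1) X.banach_mazur_commute_le[of Y Z] by (intro conjI X.banach_mazur_1_imp_almost) auto
  have dist: "X.banach_mazur Y Z = 1" if "X.isometric Y Z" "Y \<in> X.subspaces" for Y Z :: "'k X set"
    using that D(3) X.banach_mazur_isometric by blast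
  note iso = isometric_if_jordan_neumann_eq[where 'k = 'k]
  have embs: "X.isometrically_embeddable Y Z \<and> X.isometrically_embeddable Z Y"
    if "Y \<in> X.subspaces" "Z \<in> X.subspaces" "jordan_neumann Y = jordan_neumann Z" for Y Z :: "'k X set"
    using emb[OF iso[OF that(1,2,3)] that(2)] emb[OF iso[OF that(2,1) that(3)[symmetric]] that(1)] ..
  show "X.isometry_rel = (jordan_neumann_rel :: ('k X set \<times> 'k X set) set)"
    unfolding X.isometry_rel_def jordan_neumann_rel_def
    using iso bi one dist by blast
  show "X.distance_one_rel = (jordan_neumann_rel :: ('k X set \<times> 'k X set) set)"
    unfolding X.distance_one_rel_def jordan_neumann_rel_def
    using iso bi one dist by blast
  show "X.almost_isometric_biembeddability_rel = (jordan_neumann_rel :: ('k X set \<times> 'k X set) set)"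
    unfolding X.almost_isometric_biembeddability_rel_def jordan_neumann_rel_def
    using iso bi one dist by blast
  show "X.isometric_biembeddability_rel = (jordan_neumann_rel :: ('k X set \<times> 'k X set) set)"
    unfolding X.isometric_biembeddability_rel_def jordan_neumann_rel_def
    using bi almost embs by blast
qed

lemma equiv_jordan_neumann_rel:
  "equiv X.subspaces (jordan_neumann_rel :: ('k::conj_field X set \<times> 'k X set) set)"
  by (rule equivI) (auto simp: jordan_neumann_rel_def intro!: refl_onI symI transI)

section \<open>Measurability of the von Neumann--Jordan constant\<close>

text \<open>Balls of radius \<open>1 / (n + 1)\<close> around the points of a countable dense
set.\<close>

lemma X_countable_base:
  obtains \<B> :: "'k::conj_field X set set" where "countable \<B>" "\<And>B. B \<in> \<B> \<Longrightarrow> open B"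
    "\<And>U x. open U \<Longrightarrow> x \<in> U \<Longrightarrow> \<exists>B\<in>\<B>. x \<in> B \<and> B \<subseteq> U"
proof -
  obtain Q :: "'k set" where Q: "countable Q" "\<And>X. open X \<Longrightarrow> X \<noteq> {} \<Longrightarrow> \<exists>d\<in>Q. d \<in> X"
    using countable_dense_exists by (metis (no_types, lifting))
  obtain D :: "'k ell2 set" where D: "countable D" "\<And>x r. r > 0 \<Longrightarrow> \<exists>d\<in>D. norm (x - d) < r"
    by (rule ell2_countable_dense) blast
  define \<B> :: "'k X set set"
    where "\<B> = (\<lambda>(q, d, n). ball (q \<oplus>\<^sub>1 d) (inverse (real (Suc n)))) ` (Q \<times> D \<times> UNIV)"
  have "countable \<B>" unfolding \<B>_def using Q(1) D(1) by simp
  moreover have "open B" if "B \<in> \<B>" for B using that by (auto simp: \<B>_def)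
  moreover have "\<exists>B\<in>\<B>. x \<in> B \<and> B \<subseteq> U" if U: "open U" "x \<in> U" for U x
  proof -
    obtain r where r: "r > 0" "ball x r \<subseteq> U" using U open_contains_ball by blast
    obtain n where n: "inverse (real (Suc n)) < r / 2"
      using reals_Archimedean[of "r / 2"] r(1) by auto
    let ?\<delta> = "inverse (real (Suc n))"
    obtain q where q: "q \<in> Q" "norm (l1_fst x - q) < ?\<delta> / 2"
      using Q(2)[of "ball (l1_fst x) (?\<delta> / 2)"] by (auto simp: dist_norm)
    obtain d where d: "d \<in> D" "norm (l1_snd x - d) < ?\<delta> / 2" using D(2)[of "?\<delta> / 2"] by auto
    have dist: "dist (q \<oplus>\<^sub>1 d) x < ?\<delta>"
      using q(2) d(2) unfolding dist_commute[of _ x] by (simp add: dist_norm norm_l1sum_def)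
    have "ball (q \<oplus>\<^sub>1 d) ?\<delta> \<subseteq> ball x r"
    proof
      fix y assume "y \<in> ball (q \<oplus>\<^sub>1 d) ?\<delta>"
      then have "dist x y < ?\<delta> + ?\<delta>"
        using dist dist_triangle[of x y "q \<oplus>\<^sub>1 d"] by (simp add: dist_commute)
      then show "y \<in> ball x r" using n by simp
    qed
    moreover have "ball (q \<oplus>\<^sub>1 d) ?\<delta> \<in> \<B>" unfolding \<B>_def using q(1) d(1) by force
    ultimately show ?thesis using dist r(2) by (intro bexI[of _ "ball (q \<oplus>\<^sub>1 d) ?\<delta>"]) auto
  qed
  ultimately show thesis using that by blast
qed

context normed_space_over
begin

lemma effros_generator_subset: "(\<lambda>U. {Y \<in> subspaces. Y \<inter> U \<noteq> {}}) ` {U. open U} \<subseteq> Pow subspaces"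
  by blast

lemma space_effros: "space effros = subspaces"
  unfolding effros_def by (rule space_measure_of[OF effros_generator_subset])

lemma hit_set_in_effros: "open U \<Longrightarrow> {Y \<in> subspaces. Y \<inter> U \<noteq> {}} \<in> sets effros"
  unfolding effros_def sets_measure_of[OF effros_generator_subset] by (intro sigma_sets.Basic) blast

end

lemma jordan_neumann_ge_1:
  fixes Y :: "'k::conj_field X set"
  assumes "Y \<in> X.subspaces"
  shows "1 \<le> jordan_neumann Y"
proof -
  obtain s where "profile s Y" using profile_exists[OF assms] .
  then show ?thesis using jordan_neumann_profile by (fastforce simp: profile_def)
qed

text \<open>Multiplying out the denominator turns the condition into a strict inequality between
continuous functions of \<open>(x, y)\<close>, which \<open>x = y = 0\<close> never satisfies.\<close>

lemma jordan_neumann_greater_iff: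
  assumes "Y \<noteq> {}" "0 \<le> a"
  shows "a < jordan_neumann Y \<longleftrightarrow>
    (\<exists>x\<in>Y. \<exists>y\<in>Y. a * (2 * ((norm x)\<^sup>2 + (norm y)\<^sup>2)) < (norm (x + y))\<^sup>2 + (norm (x - y))\<^sup>2)"
proof
  assume "a < jordan_neumann Y"
  then show "\<exists>x\<in>Y. \<exists>y\<in>Y. a * (2 * ((norm x)\<^sup>2 + (norm y)\<^sup>2)) < (norm (x + y))\<^sup>2 + (norm (x - y))\<^sup>2"
    using jordan_neumann_least[OF assms] by (meson not_less)
next
  assume "\<exists>x\<in>Y. \<exists>y\<in>Y. a * (2 * ((norm x)\<^sup>2 + (norm y)\<^sup>2)) < (norm (x + y))\<^sup>2 + (norm (x - y))\<^sup>2"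
  then obtain x y where "x \<in> Y" "y \<in> Y"
    "a * (2 * ((norm x)\<^sup>2 + (norm y)\<^sup>2)) < (norm (x + y))\<^sup>2 + (norm (x - y))\<^sup>2" by blast
  then have "a * (2 * ((norm x)\<^sup>2 + (norm y)\<^sup>2)) < jordan_neumann Y * (2 * ((norm x)\<^sup>2 + (norm y)\<^sup>2))"
    using jordan_neumann_upper less_le_trans by blast
  then show "a < jordan_neumann Y" by (rule mult_right_less_imp_less) simp
qed

text \<open>For \<open>a \<ge> 1\<close> the constant exceeds \<open>a\<close> iff \<open>Y \<times>
Y\<close> meets a certain open set. That set is a countable union of open boxes \<open>A \<times>
B\<close>, and \<open>Y \<times> Y\<close> meets \<open>A \<times> B\<close> iff \<open>Y\<close> meets
both \<open>A\<close> and \<open>B\<close>, which is an Effros--Borel condition. For \<open>a < 1\<close>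
there is nothing to do, the constant being at least \<open>1\<close>.\<close>

lemma borel_measurable_jordan_neumann:
  "jordan_neumann \<in> borel_measurable (X.effros :: 'k::conj_field X set measure)"
  unfolding borel_measurable_iff_greater X.space_effros
proof
  fix a :: real
  show "{Y \<in> X.subspaces. a < jordan_neumann Y} \<in> sets (X.effros :: 'k X set measure)"
  proof (cases "a < 1")
    case True
    then have "{Y \<in> X.subspaces. a < jordan_neumann Y} = space (X.effros :: 'k X set measure)"
      unfolding X.space_effros using jordan_neumann_ge_1 by force
    then show ?thesis by simp
  next
    case False
    define G :: "('k X \<times> 'k X) set" where
      "G = {p. a * (2 * ((norm (fst p))\<^sup>2 + (norm (snd p))\<^sup>2)) < (norm (fst p + snd p))\<^sup>2 + (norm (fst p - snd p))\<^sup>2}"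
    have G: "open G" unfolding G_def by (intro open_Collect_less continuous_intros)
    obtain \<B> :: "'k X set set" where \<B>: "countable \<B>" "\<And>B. B \<in> \<B> \<Longrightarrow> open B"
      "\<And>U x. open U \<Longrightarrow> x \<in> U \<Longrightarrow> \<exists>B\<in>\<B>. x \<in> B \<and> B \<subseteq> U"
      by (rule X_countable_base) blast
    define I where "I = {(A, B) \<in> \<B> \<times> \<B>. A \<times> B \<subseteq> G}"
    have box: "\<exists>(A, B)\<in>I. x \<in> A \<and> y \<in> B" if xy: "(x, y) \<in> G" for x y
    proof -
      obtain U V where UV: "open U" "open V" "x \<in> U" "y \<in> V" "U \<times> V \<subseteq> G"
        by (rule open_prod_elim[OF G xy]) blast
      obtain A where "A \<in> \<B>" "x \<in> A" "A \<subseteq> U" using \<B>(3) UV by blast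
      moreover obtain B where "B \<in> \<B>" "y \<in> B" "B \<subseteq> V" using \<B>(3) UV by blast
      ultimately show ?thesis using UV(5) by (intro bexI[of _ "(A, B)"]) (auto simp: I_def)
    qed
    have "{Y \<in> X.subspaces. a < jordan_neumann Y} = (\<Union>(A, B)\<in>I.
        {Y \<in> X.subspaces. Y \<inter> A \<noteq> {}} \<inter> {Y \<in> X.subspaces. Y \<inter> B \<noteq> {}})" (is "?L = ?R")
    proof (intro equalityI subsetI)
      fix Y assume "Y \<in> ?L"
      then have Y: "Y \<in> X.subspaces" "a < jordan_neumann Y" by auto
      have "Y \<noteq> {}" using Y(1) X.subspace_0 unfolding X.subspaces_def by blast
      then obtain x y where "x \<in> Y" "y \<in> Y" "(x, y) \<in> G"
        using Y(2) False jordan_neumann_greater_iff[of Y a] by (auto simp: G_def)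
      obtain A B where "(A, B) \<in> I" "x \<in> A" "y \<in> B" using box[OF \<open>(x, y) \<in> G\<close>] by auto
      with \<open>x \<in> Y\<close> \<open>y \<in> Y\<close> Y(1) show "Y \<in> ?R" by (intro UN_I[of "(A, B)"]) auto
    next
      fix Y assume "Y \<in> ?R"
      then obtain A B x y where *: "Y \<in> X.subspaces" "(A, B) \<in> I" "x \<in> Y" "x \<in> A" "y \<in> Y" "y \<in> B"
        by auto
      then have "(x, y) \<in> G" by (auto simp: I_def)
      then show "Y \<in> ?L"
        using * False jordan_neumann_greater_iff[of Y a] by (auto simp: G_def)
    qed
    moreover have "?R \<in> sets X.effros"
    proof (rule sets.countable_UN')
      have "I \<subseteq> \<B> \<times> \<B>" unfolding I_def by blast
      then show "countable I" by (rule countable_subset) (intro countable_SIGMA \<B>(1))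
      show "(\<lambda>(A, B). {Y \<in> X.subspaces. Y \<inter> A \<noteq> {}} \<inter> {Y \<in> X.subspaces. Y \<inter> B \<noteq> {}}) ` I \<subseteq> sets X.effros"
        using \<B>(2) by (auto simp: I_def intro!: sets.Int X.hit_set_in_effros)
    qed
    ultimately show ?thesis by simp
  qed
qed

section \<open>A Borel family of pairwise non-isometric subspaces\<close>

text \<open>The span of \<open>1 \<oplus> h\<close> and of \<open>0 \<oplus> v\<close> for all
\<open>v\<close> with zeroth coordinate \<open>0\<close>, where \<open>h\<close> is \<open>exp r\<close>
times the zeroth unit vector. The exponential makes \<open>\<parallel>h\<parallel>\<close> an injective
function of \<open>r \<in> \<real>\<close>.\<close>

definition slope_subspace :: "real \<Rightarrow> 'k::conj_field X set"
  where "slope_subspace r = {x. ell2_nth (l1_snd x) 0 = of_real (exp r) * l1_fst x}"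

lemma slope_subspace_eq_range:
  "slope_subspace r = range (\<lambda>(a, f). a \<oplus>\<^sub>1 ell2_cons (of_real (exp r) * a) f)"
proof (intro equalityI subsetI)
  fix x :: "'a X" assume "x \<in> slope_subspace r"
  then have "ell2_nth (l1_snd x) 0 = of_real (exp r) * l1_fst x" by (simp add: slope_subspace_def)
  then have "x = l1_fst x \<oplus>\<^sub>1 ell2_cons (of_real (exp r) * l1_fst x) (ell2_tail (l1_snd x))"
    using ell2_cons_nth_0_tail[of "l1_snd x"] by (intro l1sum.expand) simp
  then show "x \<in> range (\<lambda>(a, f). a \<oplus>\<^sub>1 ell2_cons (of_real (exp r) * a) f)"
    by (intro image_eqI[of _ _ "(l1_fst x, ell2_tail (l1_snd x))"]) simp_all
qed (auto simp: slope_subspace_def ell2_cons.rep_eq)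

lemma profile_slope_subspace: "profile (1 / (1 + exp r)) (slope_subspace r :: 'k::conj_field X set)"
proof (rule profileI)
  define s where "s = 1 / (1 + exp r)"
  have "1 + exp r > 0" by (simp add: add_pos_pos)
  then have s: "0 < s" "s \<le> 1" "1 - s = exp r * s" by (simp_all add: s_def field_simps)
  define T where "T x = (of_real s * l1_fst x) \<oplus>\<^sub>1 ell2_cons (of_real (1 - s) * l1_fst x) (l1_snd x)"
    for x :: "'k X"
  show "0 \<le> 1 / (1 + exp r)" "1 / (1 + exp r) \<le> 1" using s unfolding s_def by simp_all
  have "of_real (1 - s) * (l1_fst (x + y)) = of_real (1 - s) * l1_fst x + of_real (1 - s) * l1_fst y"
    for x y :: "'k X" by (simp add: distrib_left)
  then show "X.linear_on UNIV T"
    unfolding X.linear_on_def T_def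
    by (auto intro!: l1sum.expand simp: ell2_cons_add[symmetric] ell2_cons_scale[symmetric] distrib_left mult.left_commute
         simp del: of_real_diff)
  show "norm (T x) = model_norm (1 / (1 + exp r)) x" for x
  proof -
    have "norm (ell2_cons (of_real (1 - s) * l1_fst x) (l1_snd x))
        = sqrt ((1 - s)\<^sup>2 * (norm (l1_fst x))\<^sup>2 + (norm (l1_snd x))\<^sup>2)"
      using norm_ell2_cons[of "of_real (1 - s) * l1_fst x" "l1_snd x"] s(2)
      by (intro real_sqrt_unique[symmetric])
         (simp_all add: norm_mult power_mult_distrib del: of_real_diff)
    then show ?thesis
      using s(1) by (simp add: T_def norm_l1sum_def model_norm_def norm_mult s_def[symmetric] del: of_real_diff)
  qed
  show "range T = slope_subspace r"
    unfolding slope_subspace_eq_range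
  proof (intro equalityI subsetI)
    fix y assume "y \<in> range T"
    then obtain x where "y = T x" by blast
    then show "y \<in> range (\<lambda>(a, f). a \<oplus>\<^sub>1 ell2_cons (of_real (exp r) * a) f)"
      by (intro image_eqI[of _ _ "(of_real s * l1_fst x, l1_snd x)"])
         (simp_all add: T_def s(3) mult.assoc del: of_real_diff)
  next
    fix y :: "'k X" assume "y \<in> range (\<lambda>(a, f). a \<oplus>\<^sub>1 ell2_cons (of_real (exp r) * a) f)"
    then obtain a f where "y = a \<oplus>\<^sub>1 ell2_cons (of_real (exp r) * a) f" by auto
    then have "y = T ((a / of_real s) \<oplus>\<^sub>1 f)"
      using s(1) by (simp add: T_def s(3) del: of_real_diff)
    then show "y \<in> range T" by blast
  qed
qed

lift_definition ell2_unit :: "nat \<Rightarrow> 'a::real_normed_field ell2" is "\<lambda>n i. if i = n then 1 else 0"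
  by (rule summable_finite[of "{n}" for n]) auto

lemma slope_subspace_in_subspaces: "(slope_subspace r :: 'k::conj_field X set) \<in> X.subspaces"
proof -
  have sub: "X.subspace (slope_subspace r :: 'k X set)"
    unfolding X.subspace_def slope_subspace_def
    by (auto simp: zero_ell2.rep_eq plus_ell2.rep_eq scale_ell2.rep_eq algebra_simps)
  have "closed (slope_subspace r :: 'k X set)"
    unfolding slope_subspace_def
    by (intro closed_Collect_eq continuous_intros linear_continuous_on bounded_linear_l1_fst
        bounded_linear_l1_snd)
  moreover have "X.infinite_dimensional (slope_subspace r :: 'k X set)"
    unfolding X.infinite_dimensional_def
  proof (rule notI, elim exE conjE)
    fix B :: "'k X set" assume B: "finite B" "X.span B = slope_subspace r"
    \<comment> \<open>Independent vectors in the subspace; the zeroth coordinate has to be skipped.\<close>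
    define e :: "nat \<Rightarrow> 'k X" where "e n = 0 \<oplus>\<^sub>1 ell2_unit (Suc n)" for n
    have coord: "ell2_nth (l1_snd (e n)) (Suc m) = (if m = n then 1 else 0)" for m n
      by (simp add: e_def ell2_unit.rep_eq)
    have "inj e" by (rule injI) (metis coord zero_neq_one)
    have "X.independent (range e)"
      unfolding X.dependent_def
    proof (rule notI, elim bexE)
      fix x assume "x \<in> range e" and x: "x \<in> X.span (range e - {x})"
      then obtain n where n: "x = e n" by blast
      have "X.span (range e - {x}) \<subseteq> {y. ell2_nth (l1_snd y) (Suc n) = 0}"
      proof (rule X.span_minimal)
        show "range e - {x} \<subseteq> {y. ell2_nth (l1_snd y) (Suc n) = 0}" using n coord by auto
        show "X.subspace {y :: 'k X. ell2_nth (l1_snd y) (Suc n) = 0}"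
          unfolding X.subspace_def
          by (auto simp: zero_ell2.rep_eq plus_ell2.rep_eq scale_ell2.rep_eq)
      qed
      then show False using x n coord[of n n] by auto
    qed
    moreover have "range e \<subseteq> X.span B"
      unfolding B(2) by (auto simp: slope_subspace_def e_def ell2_unit.rep_eq)
    ultimately have "finite (range e)" using X.independent_span_bound[OF B(1)] by blast
    then show False using \<open>inj e\<close> finite_imageD infinite_UNIV_nat by blast
  qed
  ultimately show ?thesis using sub by (simp add: X.subspaces_def)
qed

lemma bounded_linear_ell2_cons_0: "bounded_linear (\<lambda>a. ell2_cons a 0)"
  by (rule bounded_linear_intro[where K = 1])
     (auto simp: norm_ell2_cons_0 ell2_cons_add[symmetric] intro!: ell2_eqI
       simp: ell2_cons.rep_eq scaleR_ell2.rep_eq zero_ell2.rep_eq split: nat.split)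

text \<open>Fix the free parameters \<open>a\<close> and \<open>f\<close> of a vector in the subspace and
let \<open>r\<close> vary: this is a continuous curve. So the parameters \<open>r\<close> whose subspace
meets an open set form a union of open sets.\<close>

lemma measurable_slope_subspace:
  "(slope_subspace :: real \<Rightarrow> 'k::conj_field X set) \<in> borel \<rightarrow>\<^sub>M X.effros"
  unfolding X.effros_def
proof (rule measurable_measure_of[OF X.effros_generator_subset])
  show "slope_subspace \<in> space borel \<rightarrow> (X.subspaces :: 'k X set set)"
    using slope_subspace_in_subspaces by blast
  fix H :: "'k X set set" assume "H \<in> (\<lambda>U. {Y \<in> X.subspaces. Y \<inter> U \<noteq> {}}) ` {U. open U}"
  then obtain U :: "'k X set" where U: "open U" "H = {Y \<in> X.subspaces. Y \<inter> U \<noteq> {}}" by blast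
  define \<phi> :: "'k \<times> 'k ell2 \<Rightarrow> real \<Rightarrow> 'k X"
    where "\<phi> = (\<lambda>(a, f) r. a \<oplus>\<^sub>1 ell2_cons (of_real (exp r) * a) f)"
  have "continuous_on UNIV (\<phi> p)" for p
  proof -
    obtain a f where p: "p = (a, f)" by fastforce
    have "\<phi> p = (\<lambda>r. (a \<oplus>\<^sub>1 ell2_cons 0 f) + (0 \<oplus>\<^sub>1 ell2_cons (of_real (exp r) * a) 0))"
      unfolding p \<phi>_def by (intro ext l1sum.expand) (simp add: ell2_cons_add[symmetric])
    then show ?thesis
      by (simp only:) (intro continuous_intros bounded_linear.continuous_on[OF bounded_linear_Oplus_0]
          bounded_linear.continuous_on[OF bounded_linear_ell2_cons_0])
  qed
  then have "open (\<Union>p. \<phi> p -` U)"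
    using U(1) by (intro open_UN) (simp add: open_vimage)
  moreover have "slope_subspace -` H \<inter> space borel = (\<Union>p. \<phi> p -` U)"
    unfolding U(2) using slope_subspace_in_subspaces
    by (auto simp: slope_subspace_eq_range \<phi>_def) 
  ultimately show "slope_subspace -` H \<inter> space borel \<in> sets borel" by simp
qed

lemma jordan_neumann_slope_subspace_inj:
  assumes "jordan_neumann (slope_subspace r :: 'k::conj_field X set) = jordan_neumann (slope_subspace t :: 'k X set)"
  shows "r = t"
proof -
  have pos: "1 + exp r > 0" "1 + exp t > 0" by (simp_all add: add_pos_pos)
  define s s' where "s = 1 / (1 + exp r)" "s' = 1 / (1 + exp t)"
  have "s \<le> 1" "s' \<le> 1" using pos by (simp_all add: s_s'_def)
  moreover have "2 / (2 - s) = 2 / (2 - s')"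
    using assms unfolding jordan_neumann_profile[OF profile_slope_subspace] s_s'_def .
  ultimately have "s = s'" by (simp add: field_simps)
  then show ?thesis using pos by (simp add: s_s'_def field_simps)
qed

section \<open>Bireducibility with equality of real numbers\<close>

lemma borel_bireducible_jordan_neumann_rel:
  "borel_bireducible (X.effros :: 'k::conj_field X set measure) jordan_neumann_rel (borel :: real measure) Id"
proof -
  have Id: "equiv (space (borel :: real measure)) Id"
    by (rule equivI) (auto simp: refl_on_def sym_def trans_def)
  have "borel_reducible (X.effros :: 'k X set measure) jordan_neumann_rel (borel :: real measure) Id"
    unfolding borel_reducible_def X.space_effros
    using equiv_jordan_neumann_rel Id borel_measurable_jordan_neumann
    by (intro conjI bexI[of _ jordan_neumann]) (auto simp: jordan_neumann_rel_def)
  moreover have "borel_reducible (borel :: real measure) Id (X.effros :: 'k X set measure) jordan_neumann_rel"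
    unfolding borel_reducible_def X.space_effros
    using equiv_jordan_neumann_rel Id measurable_slope_subspace slope_subspace_in_subspaces
      jordan_neumann_slope_subspace_inj
    by (intro conjI bexI[of _ slope_subspace]) (auto simp: jordan_neumann_rel_def)
  ultimately show ?thesis by (simp add: borel_bireducible_def)
qed

theorem theorem1p4:
  shows
   "(\<forall>E \<in> {X.isometry_rel, X.distance_one_rel,
            X.isometric_biembeddability_rel, X.almost_isometric_biembeddability_rel}.
       borel_bireducible (X.effros :: real X set measure) E (borel :: real measure) Id) \<and>
    (\<forall>E \<in> {X.isometry_rel, X.distance_one_rel,
            X.isometric_biembeddability_rel, X.almost_isometric_biembeddability_rel}.
       borel_bireducible (X.effros :: complex X set measure) E (borel :: real measure) Id)"
  by (simp add: relations_eq_jordan_neumann_rel borel_bireducible_jordan_neumann_rel)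

end
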